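(* Let $D_{\mathrm i}>0$ and $\beta>0$ be constants, and let $H:[0,\infty)\to\mathbb{R}$ be a continuously differentiable function (the sea ice thickness) satisfying: (i) there exists $\bar H>0$ such that $0<H(t)<\bar H$ for all $t>0$; (ii) there exists $M>0$ such that $|\dot H(t)|<M$ for all $t>0$. Let $\lambda>0$, $c>0$ and $\varepsilon>0$ be free parameters. Consider the estimation error system for $(\tilde T,\tilde H)$: \begin{align*} \frac{\partial \tilde T}{\partial t}(x,t) &= D_{\mathrm i}\frac{\partial^2\tilde T}{\partial x^2}(x,t) - p_1(x,t)\tilde H(t), \qquad x\in(0,H(t)),\\ \tilde T(0,t) &= -p_2(t)\tilde H(t),\\ \tilde T(H(t),t) &= -p_3(t)\tilde H(t),\\ \dot{\tilde H}(t) &= -p_4(t)\tilde H(t) - \beta\frac{\partial\tilde T}{\partial x}(H(t),t), \end{align*} with the observer gains \begin{align*} p_1(x,t) &= \frac{c\lambda}{\beta}\,x\,\frac{I_1(z)}{z} + \left(\frac{\varepsilon H(t)}{D_{\mathrm i}}-\frac{3}{\beta}\right)\lambda^2 x\,\frac{I_2(z)}{z^2} + \frac{\lambda^3}{D_{\mathrm i}\beta}\,x^3\,\frac{I_3(z)}{z^3},\\ p_2(t) &= 0,\\ p_3(t) &= -\frac{\lambda}{2\beta}H(t)-\varepsilon,\\ p_4(t) &= c-\frac{\lambda}{2}\left(1-\frac{\lambda H(t)^2}{8D_{\mathrm i}}\right)+\frac{\beta\lambda}{2D_{\mathrm i}}\,\varepsilon H(t), \end{align*} where $z=\sqrt{\frac{\lambda}{D_{\mathrm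 i}}\left(H(t)^2-x^2\right)}$. Then there exist positive constants $c^*>0$ and $\tilde M>0$ such that, for all $c>c^*$, the norm $$\Phi(t):=\int_0^{H(t)}\tilde T(x,t)^2\,dx+\tilde H(t)^2$$ satisfies, along solutions of the estimation error system, the exponential decay $$\Phi(t)\le \tilde M\,\Phi(0)\,e^{-\min\{\lambda,c\}\,t},$$ i.e. the origin of the estimation error system is exponentially stable in the spatial $L_2$ norm.
   Context: $I_j(\cdot)$ denotes the modified Bessel function of the first kind of order $j$; the quotients $I_j(z)/z^j$ are extended by continuity to $z=0$. A dot denotes the time derivative. Solutions $(\tilde T,\tilde H)$ are understood in the classical sense, sufficiently smooth for the equations and boundary conditions to hold pointwise for $t>0$ and with $\Phi$ continuous at $t=0$. The function $H(t)$ is regarded as a given (measured) function of time. Origin of the error system: the simplified (salinity-free) sea ice temperature $T_{\mathrm i}(x,t)$ satisfies $\partial_t T_{\mathrm i}=D_{\mathrm i}\,\partial_{xx}T_{\mathrm i}+\bar I_0\kappa_{\mathrm i}e^{-\kappa_{\mathrm i}x}$ on $(0,H(t))$, $T_{\mathrm i}(H(t),t)=T_{\mathrm m2}$, and $\dot H(t)=\beta\,\partial_xT_{\mathrm i}(H(t),t)-F_{\mathrm w}/q$, where $\beta=k_{\mathrm i}/q$ and $D_{\mathrm i}=k_0/(\rho c_0)$ are positive physical constants. The measurements are $H(t)$ and $T_{\mathrm i}(0,t)$. The observer state $(\hat T_{\mathrm i},\hat H)$ satisfies $\partial_t\hat T_{\mathrm i}=D_{\mathrm i}\,\partial_{xx}\hat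 T_{\mathrm i}+\bar I_0\kappa_{\mathrm i}e^{-\kappa_{\mathrm i}x}-p_1(x,t)(H(t)-\hat H(t))$ on $(0,H(t))$, $\hat T_{\mathrm i}(0,t)=T_{\mathrm i}(0,t)-p_2(t)(H(t)-\hat H(t))$, $\hat T_{\mathrm i}(H(t),t)=T_{\mathrm m2}-p_3(t)(H(t)-\hat H(t))$, $\dot{\hat H}(t)=p_4(t)(H(t)-\hat H(t))+\beta\,\partial_x\hat T_{\mathrm i}(H(t),t)-F_{\mathrm w}/q$. The estimation errors are $\tilde T:=-(T_{\mathrm i}-\hat T_{\mathrm i})$ and $\tilde H:=H-\hat H$. The constants $c^*$ and $\tilde M$ may depend on $D_{\mathrm i},\beta,\lambda,\varepsilon,\bar H,M$. *)

theory Defs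
  imports "HOL-Analysis.Analysis"
begin

definition bessel_I :: "nat \<Rightarrow> real \<Rightarrow> real" where
  "bessel_I j z = (\<Sum>m. (z / 2) ^ (2 * m + j) / (fact m * fact (m + j)))"

text \<open>The quotient \<open>I\<^sub>j(z) / z\<^sup>j\<close>, extended by continuity to \<open>z = 0\<close>
  (see \<open>isCont_bessel_I_quot\<close> below).\<close>

definition bessel_I_quot :: "nat \<Rightarrow> real \<Rightarrow> real" where
  "bessel_I_quot j z = (if z = 0 then 1 / (2 ^ j * fact j) else bessel_I j z / z ^ j)"

lemma summable_bessel_I_quot:
  "summable (\<lambda>m. 1 / (2 ^ j * 4 ^ m * fact m * fact (m + j)) * (y::real) ^ m)"
proof (rule summable_comparison_test')
  show "summable (\<lambda>m. inverse (fact m) * \<bar>y\<bar> ^ m)"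
    using summable_exp[of "\<bar>y\<bar>"] by simp
  fix m :: nat
  have "(1::real) \<le> 2 ^ j * 4 ^ m * fact (m + j)"
    using mult_mono[of 1 "2 ^ j * 4 ^ m" 1 "fact (m + j) :: real"]
      mult_mono[of 1 "2 ^ j" 1 "4 ^ m :: real"] by simp
  then have "(fact m :: real) \<le> fact m * (2 ^ j * 4 ^ m * fact (m + j))"
    by (metis fact_ge_zero mult.right_neutral mult_left_mono)
  then have "1 / (fact m * (2 ^ j * 4 ^ m * fact (m + j))) \<le> (1 / fact m :: real)"
    by (intro divide_left_mono) auto
  then have "1 / (2 ^ j * 4 ^ m * fact m * fact (m + j)) \<le> (inverse (fact m) :: real)"
    by (simp add: field_simps)
  then show "norm (1 / (2 ^ j * 4 ^ m * fact m * fact (m + j)) * y ^ m)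
      \<le> inverse (fact m) * \<bar>y\<bar> ^ m"
    using mult_right_mono[of _ _ "\<bar>y\<bar> ^ m"]
    by (simp add: abs_mult power_abs del: times_divide_eq_left)
qed

lemma bessel_I_quot_series:
  "bessel_I_quot j z = (\<Sum>m. 1 / (2 ^ j * 4 ^ m * fact m * fact (m + j)) * (z\<^sup>2) ^ m)"
proof (cases "z = 0")
  case True
  then show ?thesis
    using powser_zero[of "\<lambda>m. 1 / (2 ^ j * 4 ^ m * fact m * fact (m + j)) :: real"]
    by (simp add: bessel_I_quot_def)
next
  case False
  have *: "(z / 2) ^ (2 * m + j) / (fact m * fact (m + j))
      = z ^ j * (1 / (2 ^ j * 4 ^ m * fact m * fact (m + j)) * (z\<^sup>2) ^ m)" for m
  proof -
    have "(z / 2) ^ (2 * m + j) = z ^ j * (z\<^sup>2) ^ m / (2 ^ j * 4 ^ m)"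
      by (simp add: power_add power_mult power_divide, simp add: mult.commute)
    then show ?thesis by (simp add: mult.assoc)
  qed
  show ?thesis
    unfolding bessel_I_quot_def bessel_I_def *
    using False suminf_mult[OF summable_bessel_I_quot[of j "z\<^sup>2"], of "z ^ j"]
    by simp
qed

lemma isCont_bessel_I_quot: "isCont (bessel_I_quot j) z"
proof -
  have "isCont (\<lambda>y::real. \<Sum>m. 1 / (2 ^ j * 4 ^ m * fact m * fact (m + j)) * y ^ m) (z\<^sup>2)"
    by (rule isCont_powser_converges_everywhere) (rule summable_bessel_I_quot)
  then have "isCont (\<lambda>z. \<Sum>m. 1 / (2 ^ j * 4 ^ m * fact m * fact (m + j)) * (z\<^sup>2) ^ m) z"
    using isCont_o2[of z "\<lambda>z. z\<^sup>2"] by (simp add: continuous_intros)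
  then show ?thesis
    by (simp add: bessel_I_quot_series[abs_def])
qed

definition gain_p1 ::
    "real \<Rightarrow> real \<Rightarrow> real \<Rightarrow> real \<Rightarrow> real \<Rightarrow> (real \<Rightarrow> real) \<Rightarrow> real \<Rightarrow> real \<Rightarrow> real" where
  "gain_p1 Di \<beta> lam \<epsilon> c H x t =
    (let z = sqrt (lam / Di * ((H t)\<^sup>2 - x\<^sup>2)) in
      c * lam / \<beta> * x * bessel_I_quot 1 z
      + (\<epsilon> * H t / Di - 3 / \<beta>) * lam\<^sup>2 * x * bessel_I_quot 2 z
      + lam ^ 3 / (Di * \<beta>) * x ^ 3 * bessel_I_quot 3 z)"

definition gain_p2 :: "real \<Rightarrow> real" where
  "gain_p2 t = 0"

definition gain_p3 :: "real \<Rightarrow> real \<Rightarrow> real \<Rightarrow> (real \<Rightarrow> real) \<Rightarrow> real \<Rightarrow> real" where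
  "gain_p3 \<beta> lam \<epsilon> H t = - (lam / (2 * \<beta>)) * H t - \<epsilon>"

definition gain_p4 ::
    "real \<Rightarrow> real \<Rightarrow> real \<Rightarrow> real \<Rightarrow> real \<Rightarrow> (real \<Rightarrow> real) \<Rightarrow> real \<Rightarrow> real" where
  "gain_p4 Di \<beta> lam \<epsilon> c H t =
    c - lam / 2 * (1 - lam * (H t)\<^sup>2 / (8 * Di)) + \<beta> * lam / (2 * Di) * \<epsilon> * H t"

text \<open>At \<open>t = 0\<close> the derivative is one-sided, and the bounds are imposed only for \<open>t > 0\<close>;
  in particular \<open>H 0 = 0\<close> is allowed.\<close>

definition admissible_thickness :: "real \<Rightarrow> real \<Rightarrow> (real \<Rightarrow> real) \<Rightarrow> bool" where
  "admissible_thickness Hbar M H \<longleftrightarrow>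
    (\<exists>H'. (\<forall>t\<ge>0. (H has_real_derivative H' t) (at t within {0..})) \<and>
          continuous_on {0..} H' \<and>
          (\<forall>t>0. \<bar>H' t\<bar> < M)) \<and>
    (\<forall>t>0. 0 < H t \<and> H t < Hbar)"

definition error_norm ::
    "(real \<Rightarrow> real) \<Rightarrow> (real \<Rightarrow> real \<Rightarrow> real) \<Rightarrow> (real \<Rightarrow> real) \<Rightarrow> real \<Rightarrow> real" where
  "error_norm H T E t = integral {0..H t} (\<lambda>x. (T x t)\<^sup>2) + (E t)\<^sup>2"

text \<open>Classical solutions \<open>(T, E)\<close> of the estimation error system, where \<open>T x t\<close> is the
  temperature error and \<open>E t\<close> the thickness error; only the values of \<open>T\<close> on
  \<open>0 \<le> x \<le> H t\<close>, \<open>t \<ge> 0\<close> matter.  For \<open>t > 0\<close>, \<open>T\<close> and \<open>T\<^sub>x\<close> are continuous up to the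
  lateral boundary, as needed for the boundary conditions and the flux at \<open>x = H t\<close>
  (where \<open>T\<^sub>x\<close> is the one-sided derivative), whereas \<open>T\<^sub>t\<close> and \<open>T\<^sub>x\<^sub>x\<close> are only required
  to exist and be continuous in the interior.  At \<open>t = 0\<close> the initial profile is
  square integrable and the norm is continuous; no further regularity is imposed there.\<close>

definition error_system_solution ::
    "real \<Rightarrow> real \<Rightarrow> real \<Rightarrow> real \<Rightarrow> real \<Rightarrow> (real \<Rightarrow> real) \<Rightarrow>
     (real \<Rightarrow> real \<Rightarrow> real) \<Rightarrow> (real \<Rightarrow> real) \<Rightarrow> bool" where
  "error_system_solution Di \<beta> lam \<epsilon> c H T E \<longleftrightarrow>
    (\<exists>Tt Tx Txx.
      continuous_on {(x, t). 0 < t \<and> 0 \<le> x \<and> x \<le> H t} (\<lambda>(x, t). T x t) \<and>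
      continuous_on {(x, t). 0 < t \<and> 0 \<le> x \<and> x \<le> H t} (\<lambda>(x, t). Tx x t) \<and>
      continuous_on {(x, t). 0 < t \<and> 0 < x \<and> x < H t} (\<lambda>(x, t). Tt x t) \<and>
      continuous_on {(x, t). 0 < t \<and> 0 < x \<and> x < H t} (\<lambda>(x, t). Txx x t) \<and>
      (\<forall>t>0. \<forall>x\<in>{0..H t}.
        ((\<lambda>\<xi>. T \<xi> t) has_real_derivative Tx x t) (at x within {0..H t})) \<and>
      (\<forall>t>0. \<forall>x\<in>{0<..<H t}.
        ((\<lambda>\<tau>. T x \<tau>) has_real_derivative Tt x t) (at t) \<and>
        ((\<lambda>\<xi>. Tx \<xi> t) has_real_derivative Txx x t) (at x) \<and>
        Tt x t = Di * Txx x t - gain_p1 Di \<beta> lam \<epsilon> c H x t * E t) \<and>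
      (\<forall>t>0. T 0 t = - gain_p2 t * E t) \<and>
      (\<forall>t>0. T (H t) t = - gain_p3 \<beta> lam \<epsilon> H t * E t) \<and>
      (\<forall>t>0. (E has_real_derivative
        (- gain_p4 Di \<beta> lam \<epsilon> c H t * E t - \<beta> * Tx (H t) t)) (at t))) \<and>
    (\<lambda>x. (T x 0)\<^sup>2) integrable_on {0..H 0} \<and>
    continuous (at 0 within {0..}) (error_norm H T E)"

end

theory Submission
  imports Defs
begin

text \<open>The observer gains come from a backstepping change of variables. Put \<open>a = \<lambda> / D\<close> and let
  \<open>k x y = a x J\<^sub>1(\<zeta>) / \<zeta>\<close> with \<open>\<zeta> = sqrt (a (y\<^sup>2 - x\<^sup>2))\<close>, which solves the wave equation
  \<open>k\<^sub>x\<^sub>x - k\<^sub>y\<^sub>y = a k\<close> with \<open>k x x = a x / 2\<close>. The new state is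
  \<open>w x t = T x t - \<integral>\<^sub>x\<^sup>H k x y T y t dy - (D / \<beta>) k x H E t\<close>.
  The kernel equations remove every term in \<open>T\<close> except a damping, and the coefficient
  \<open>(D / \<beta>) k x H\<close> of \<open>E\<close> is the one for which the boundary flux \<open>T\<^sub>x(H)\<close> disappears, so that
  \<open>w\<^sub>t = D w\<^sub>x\<^sub>x - \<lambda> w + g E\<close>, \<open>w(0) = 0\<close>, \<open>w(H) = \<epsilon> E\<close> and
  \<open>E' = - (c - \<lambda>\<^sup>2 H\<^sup>2 / (16 D)) E - \<beta> w\<^sub>x(H)\<close>.

  The source \<open>g\<close> gathers all that the gains do not cancel: the terms caused by the motion of the
  boundary and residual terms of the gains. What makes it harmless is that it does not
  depend on \<open>c\<close>. The part of the gain \<open>p\<^sub>1\<close> proportional to \<open>c\<close> is \<open>c (D / \<beta>) q x\<close> with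
  \<open>q y = a y I\<^sub>1(z) / z\<close> and \<open>z = sqrt (a (H\<^sup>2 - y\<^sup>2))\<close>. Its image under the change of variables cancels
  the term \<open>c (D / \<beta>) k x H\<close> that \<open>p\<^sub>4\<close> contributes through \<open>E'\<close>, because the kernels with \<open>I\<^sub>1\<close> and with \<open>J\<^sub>1\<close> are resolvents of each other:
  \<open>\<integral>\<^sub>x\<^sup>H k x y q y dy = q x - k x H\<close> (\<open>obs_kernel_resolvent\<close>). Therefore
  \<open>\<bar>g\<bar> \<le> K\<close> with \<open>K\<close> depending only on the data (\<open>source_coeff_bounded\<close>), and likewise the residue
  \<open>\<lambda>\<^sup>2 H\<^sup>2 / (16 D)\<close> in the thickness equation is bounded independently of \<open>c\<close>.

  For \<open>V = (1 / 2) \<integral> w\<^sup>2 + (\<epsilon> D / (2 \<beta>)) E\<^sup>2\<close> the two boundary terms \<open>\<plusminus> \<epsilon> D E w\<^sub>x(H)\<close> cancel. Young's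
  inequality spends half of the damping \<open>\<lambda> \<integral> w\<^sup>2\<close> on \<open>g E w\<close>; what then remains in \<open>E\<^sup>2\<close>, together
  with the boundary motion, is dominated by half of the damping of \<open>E\<close> as soon as \<open>c\<close> exceeds a
  constant. The other halves give \<open>V' \<le> - min \<lambda> c V\<close> (\<open>V'_le\<close>). The functional \<open>V\<close> and
  the error norm are equivalent with constants independent of \<open>c\<close>, since \<open>w\<close> arises from
  \<open>T\<close> by a Volterra operator with bounded kernel, inverted by Gronwall's inequality
  (\<open>Volterra_transform_L2_bounds\<close>). Decay on \<open>[s, t]\<close> for every \<open>s > 0\<close> extends to \<open>s = 0\<close> by
  continuity of the error norm.

  Since \<open>T\<^sub>t\<close> and \<open>T\<^sub>x\<^sub>x\<close> may be unbounded near the two ends of the ice, integrals over the ice cannot be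
  differentiated under the integral sign. The integral in \<open>w\<close> and the energy of \<open>w\<close>
  both have densities satisfying a conservation law \<open>u\<^sub>t = P\<^sub>x + S\<close> whose flux and source are
  continuous up to the boundary, and this suffices (\<open>DERIV_integral_conservation_law\<close>).\<close>

section \<open>Entire Bessel quotients\<close>

text \<open>As a function of \<open>s = z\<^sup>2\<close> the quotient \<open>I\<^sub>j(z) / z\<^sup>j\<close> is entire, and its values at negative \<open>s\<close> are
  \<open>J\<^sub>j(\<zeta>) / \<zeta>\<^sup>j\<close> with \<open>\<zeta> = sqrt (- s)\<close>; a single family thus provides the gains and the kernel of the
  change of variables.\<close>

definition bessel_entire :: "nat \<Rightarrow> real \<Rightarrow> real" where
  "bessel_entire j s = (\<Sum>m. 1 / (2 ^ j * 4 ^ m * fact m * fact (m + j)) * s ^ m)"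

lemma bessel_I_quot_eq_entire: "bessel_I_quot j z = bessel_entire j (z\<^sup>2)"
  by (simp add: bessel_I_quot_series bessel_entire_def)

lemma bessel_entire_sums:
  "(\<lambda>m. 1 / (2 ^ j * 4 ^ m * fact m * fact (m + j)) * s ^ m) sums bessel_entire j s"
  unfolding bessel_entire_def by (rule summable_sums) (rule summable_bessel_I_quot)

lemma summable_norm_bessel_entire:
  "summable (\<lambda>m. norm (1 / (2 ^ j * 4 ^ m * fact m * fact (m + j)) * (s::real) ^ m))"
  using summable_bessel_I_quot[of j "\<bar>s\<bar>"] by (simp add: abs_mult power_abs)

lemma DERIV_bessel_entire:
  "(bessel_entire j has_real_derivative bessel_entire (Suc j) s / 2) (at s)"
proof -
  have *: "diffs (\<lambda>m. 1 / (2 ^ j * 4 ^ m * fact m * fact (m + j)) :: real) m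
      = 1 / (2 ^ Suc j * 4 ^ m * fact m * fact (m + Suc j)) / 2" for m
  proof -
    have f: "fact (Suc m) = real (Suc m) * fact m" "fact (m + Suc j) = (fact (Suc m + j) :: real)"
      by simp_all
    have "real (Suc m) \<noteq> 0" "(fact (Suc m + j) :: real) \<noteq> 0" by simp_all
    then show ?thesis
      unfolding diffs_def f by (simp add: divide_simps del: of_nat_Suc fact_Suc)
  qed
  have "((\<lambda>x. \<Sum>m. 1 / (2 ^ j * 4 ^ m * fact m * fact (m + j)) * x ^ m) has_field_derivative
      (\<Sum>m. diffs (\<lambda>m. 1 / (2 ^ j * 4 ^ m * fact m * fact (m + j))) m * s ^ m)) (at s)"
    by (rule termdiffs_strong_converges_everywhere) (rule summable_bessel_I_quot)
  also have "(\<Sum>m. diffs (\<lambda>m. 1 / (2 ^ j * 4 ^ m * fact m * fact (m + j))) m * s ^ m)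
      = bessel_entire (Suc j) s / 2"
    using sums_unique[OF sums_divide[OF bessel_entire_sums[of "Suc j" s], of 2]]
    unfolding * by simp
  finally show ?thesis
    by (simp add: bessel_entire_def[abs_def])
qed

lemma continuous_on_bessel_entire [continuous_intros]:
  "continuous_on A f \<Longrightarrow> continuous_on A (\<lambda>x. bessel_entire j (f x))"
  by (rule continuous_on_compose2[OF _ _ subset_UNIV])
    (auto intro: DERIV_continuous_on DERIV_bessel_entire)

lemma bessel_entire_0: "bessel_entire j 0 = 1 / (2 ^ j * fact j)"
  using powser_zero[of "\<lambda>m. 1 / (2 ^ j * 4 ^ m * fact m * fact (m + j)) :: real"]
  by (simp add: bessel_entire_def)

text \<open>The three-term recurrence of the Bessel functions; combined with \<open>DERIV_bessel_entire\<close> it is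
  Bessel's differential equation.\<close>

lemma bessel_entire_recurrence:
  "bessel_entire j s = 2 * (real j + 1) * bessel_entire (Suc j) s + s * bessel_entire (Suc (Suc j)) s"
proof -
  let ?c = "\<lambda>j m. 1 / (2 ^ j * 4 ^ m * fact m * fact (m + j)) :: real"
  have "(\<lambda>m. s * (?c (Suc (Suc j)) m * s ^ m)) sums (s * bessel_entire (Suc (Suc j)) s)"
    by (rule sums_mult[OF bessel_entire_sums])
  then have "(\<lambda>m. case m of 0 \<Rightarrow> 0 | Suc m \<Rightarrow> s * (?c (Suc (Suc j)) m * s ^ m))
      sums (s * bessel_entire (Suc (Suc j)) s)"
    by (subst sums_Suc_iff[symmetric, where f = "\<lambda>m. case m of 0 \<Rightarrow> 0 | Suc m \<Rightarrow> s * (?c (Suc (Suc j)) m * s ^ m)",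
        simplified] | simp)+
  then have "(\<lambda>m. 2 * (real j + 1) * (?c (Suc j) m * s ^ m)
        + (case m of 0 \<Rightarrow> 0 | Suc m \<Rightarrow> s * (?c (Suc (Suc j)) m * s ^ m)))
      sums (2 * (real j + 1) * bessel_entire (Suc j) s + s * bessel_entire (Suc (Suc j)) s)"
    by (intro sums_add sums_mult bessel_entire_sums)
  moreover have "2 * (real j + 1) * (?c (Suc j) m * s ^ m)
        + (case m of 0 \<Rightarrow> 0 | Suc m \<Rightarrow> s * (?c (Suc (Suc j)) m * s ^ m)) = ?c j m * s ^ m" for m
  proof (cases m)
    case 0
    have "fact (0 + Suc j) = (real j + 1) * fact j" "real j + 1 \<noteq> 0"
      by simp_all
    then show ?thesis using 0 by (simp add: divide_simps del: fact_Suc)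
  next
    case (Suc k)
    have "2 * (real j + 1) * ?c (Suc j) (Suc k) + ?c (Suc (Suc j)) k = ?c j (Suc k)"
    proof -
      have f: "fact (Suc k + Suc j) = (real k + real j + 2) * fact (Suc k + j)"
        "fact (k + Suc (Suc j)) = (real k + real j + 2) * fact (Suc k + j)"
        "fact (Suc k) = (real k + 1) * fact k"
        by (simp_all add: algebra_simps)
      have "real k + real j + 2 \<noteq> 0" "real k + 1 \<noteq> 0" by linarith+
      then show ?thesis
        unfolding f by (simp add: divide_simps) (simp add: algebra_simps)
    qed
    then have "(2 * (real j + 1) * ?c (Suc j) (Suc k) + ?c (Suc (Suc j)) k) * s ^ Suc k
        = ?c j (Suc k) * s ^ Suc k" by simp
    then show ?thesis using Suc by (simp add: algebra_simps)
  qed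
  ultimately show ?thesis
    using sums_unique2[OF bessel_entire_sums[of j s]] by simp
qed

lemma DERIV_divided_power:
  "((\<lambda>x::real. x ^ Suc m / fact (Suc m)) has_real_derivative x ^ m / fact m) (at x within A)"
proof -
  have "((\<lambda>x. x ^ Suc m / fact (Suc m)) has_real_derivative real (Suc m) * x ^ (Suc m - Suc 0) / fact (Suc m))
    (at x within A)"
    by (rule DERIV_cdivide) (rule DERIV_subset[OF DERIV_pow subset_UNIV])
  then show ?thesis by simp
qed

text \<open>The beta integral at positive integers. Writing it with divided powers turns the integration
  by parts into a shift of \<open>(m, n)\<close> along \<open>m + n\<close>.\<close>

lemma has_integral_beta:
  assumes "0 \<le> (S::real)"
  shows "((\<lambda>s. s ^ m / fact m * ((S - s) ^ n / fact n)) has_integral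
    S ^ (m + n + 1) / fact (m + n + 1)) {0..S}"
proof (induction n arbitrary: m)
  case 0
  have "((\<lambda>s. s ^ m / fact m) has_integral S ^ Suc m / fact (Suc m) - 0 ^ Suc m / fact (Suc m)) {0..S}"
    using assms
    by (intro fundamental_theorem_of_calculus)
      (auto intro!: DERIV_divided_power simp: has_real_derivative_iff_has_vector_derivative[symmetric]
        simp del: power_Suc fact_Suc)
  then show ?case by simp
next
  case (Suc n)
  let ?F = "\<lambda>s. s ^ Suc m / fact (Suc m) * ((S - s) ^ Suc n / fact (Suc n))"
  have 2: "((\<lambda>s::real. (S - s) ^ Suc m / fact (Suc m)) has_real_derivative - ((S - s) ^ m / fact m))
      (at s within {0..S})" for m s
  proof -
    have "((\<lambda>s. S - s) has_real_derivative - 1) (at s within {0..S})"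
      by (auto intro!: derivative_eq_intros)
    from DERIV_chain2[where f = "\<lambda>x. x ^ Suc m / fact (Suc m)", OF DERIV_divided_power this]
    show ?thesis by simp
  qed
  have "((\<lambda>s. s ^ Suc m / fact (Suc m) * - ((S - s) ^ n / fact n)
      + s ^ m / fact m * ((S - s) ^ Suc n / fact (Suc n))) has_integral ?F S - ?F 0) {0..S}"
    unfolding add.commute[of "_ * - _"] diff_0
  proof (intro fundamental_theorem_of_calculus assms, unfold has_real_derivative_iff_has_vector_derivative[symmetric])
    fix s
    show "(?F has_real_derivative s ^ m / fact m * ((S - s) ^ Suc n / fact (Suc n))
        + s ^ Suc m / fact (Suc m) * - ((S - s) ^ n / fact n)) (at s within {0..S})"
      using DERIV_mult[OF DERIV_divided_power[of m s] 2[of n s]]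
      by (rule DERIV_cong) (simp add: mult_ac del: power_Suc fact_Suc)
  qed
  from has_integral_add[OF this Suc[of "Suc m"]] show ?case by simp
qed

text \<open>The alternating sum of a full row of Pascal's triangle is zero; this is the row without its two ends.\<close>

lemma sum_alternating_binomial_inner:
  "(\<Sum>m\<le>N. (-1) ^ m * real (Suc (Suc N) choose Suc m)) = 1 + (-1) ^ N"
proof -
  have "0 = (\<Sum>m\<le>Suc (Suc N). (-1) ^ m * real (Suc (Suc N) choose m))"
    using choose_alternating_sum[of "Suc (Suc N)", where 'a = real] by simp
  also have "\<dots> = (\<Sum>m\<le>Suc N. (-1) ^ m * real (Suc (Suc N) choose m)) + (-1) ^ N"
    by simp
  also have "(\<Sum>m\<le>Suc N. (-1) ^ m * real (Suc (Suc N) choose m))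
      = 1 - (\<Sum>m\<le>N. (-1) ^ m * real (Suc (Suc N) choose Suc m))"
    by (subst sum.atMost_Suc_shift) (simp add: sum_negf)
  finally show ?thesis by simp
qed

text \<open>The convolution identity behind the resolvent relation between \<open>J\<^sub>1\<close> and \<open>I\<^sub>1\<close>. In the Cauchy product
  of the two power series, the terms of total degree \<open>N\<close> integrate to beta integrals, which combine to
  an alternating row of binomial coefficients. The result \<open>1 + (-1)\<^sup>N\<close> is the sign pattern
  of a difference of the same series at \<open>a S\<close> and at \<open>- a S\<close>.\<close>

lemma bessel_entire_convolution:
  assumes S: "0 \<le> S" and a: "a \<noteq> 0"
  shows "((\<lambda>s. bessel_entire 1 (- a * s) * bessel_entire 1 (a * (S - s))) has_integral
    2 / a * (bessel_entire 1 (a * S) - bessel_entire 1 (- a * S))) {0..S}"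
    (is "(?f has_integral _) _")
proof -
  let ?b = "\<lambda>m. 1 / (2 ^ 1 * 4 ^ m * fact m * fact (m + 1)) :: real"
  define t where "t N s = (\<Sum>m\<le>N. (?b m * (- a * s) ^ m) * (?b (N - m) * (a * (S - s)) ^ (N - m)))"
    for N s
  define B where "B N = (\<Sum>m\<le>N. norm (?b m * (\<bar>a\<bar> * S) ^ m) * norm (?b (N - m) * (\<bar>a\<bar> * S) ^ (N - m)))"
    for N
  have sums_t: "(\<lambda>N. t N s) sums ?f s" for s
    unfolding t_def using Cauchy_product_sums[OF summable_norm_bessel_entire[of 1 "- a * s"]
        summable_norm_bessel_entire[of 1 "a * (S - s)"]]
    unfolding bessel_entire_def by simp
  have sumB: "summable B"
    unfolding B_def
    by (rule summable_Cauchy_product) (use summable_norm_bessel_entire[of 1 "\<bar>a\<bar> * S"] in simp_all)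
  have "uniform_limit {0..S} (\<lambda>n s. \<Sum>i<n. t i s) (\<lambda>s. \<Sum>i. t i s) sequentially"
  proof (rule Weierstrass_m_test[OF _ sumB])
    fix N s assume s: "s \<in> {0..S}"
    have p: "norm (?b m * x ^ m) \<le> norm (?b m * (\<bar>a\<bar> * S) ^ m)" if "\<bar>x\<bar> \<le> \<bar>a\<bar> * S" for x m
      using power_mono[OF that abs_ge_zero, of m] S
      by (simp add: abs_mult power_abs divide_simps power_mult_distrib)
    have "\<bar>- a * s\<bar> \<le> \<bar>a\<bar> * S" "\<bar>a * (S - s)\<bar> \<le> \<bar>a\<bar> * S"
      using s by (auto simp: abs_mult mult_left_mono)
    then have "norm ((?b m * (- a * s) ^ m) * (?b (N - m) * (a * (S - s)) ^ (N - m)))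
        \<le> norm (?b m * (\<bar>a\<bar> * S) ^ m) * norm (?b (N - m) * (\<bar>a\<bar> * S) ^ (N - m))" for m
      by (subst norm_mult) (rule mult_mono[OF p p norm_ge_zero norm_ge_zero])
    then show "norm (t N s) \<le> B N"
      unfolding t_def B_def by (intro order_trans[OF norm_sum] sum_mono)
  qed
  then have ul: "uniform_limit {0..S} (\<lambda>n s. \<Sum>i<n. t i s) ?f sequentially"
    unfolding sums_unique[OF sums_t, symmetric] .
  have tN: "(t N has_integral (a ^ N * S ^ Suc N * (1 + (-1) ^ N) / (4 * 4 ^ N * fact (Suc N) * fact (Suc (Suc N))))) {0..S}" for N
  proof -
    have "((\<lambda>s. (a ^ N / (4 * 4 ^ N) * ((-1) ^ m / (fact (Suc m) * fact (Suc (N - m))))) *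
            (s ^ m / fact m * ((S - s) ^ (N - m) / fact (N - m)))) has_integral
          (a ^ N / (4 * 4 ^ N) * ((-1) ^ m / (fact (Suc m) * fact (Suc (N - m))))) *
            (S ^ Suc N / fact (Suc N))) {0..S}" if "m \<le> N" for m
    proof -
      have "m + (N - m) + 1 = Suc N" using that by simp
      then show ?thesis
        using has_integral_mult_right[OF has_integral_beta[OF S, of m "N - m"]] by (simp only:)
    qed
    moreover have "(?b m * (- a * s) ^ m) * (?b (N - m) * (a * (S - s)) ^ (N - m)) =
        (a ^ N / (4 * 4 ^ N) * ((-1) ^ m / (fact (Suc m) * fact (Suc (N - m))))) *
            (s ^ m / fact m * ((S - s) ^ (N - m) / fact (N - m)))" if "m \<le> N" for m s
    proof -
      have "a ^ N = a ^ m * a ^ (N - m)" "(4::real) ^ N = 4 ^ m * 4 ^ (N - m)"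
        using that by (simp_all flip: power_add)
      moreover have "(- a * s) ^ m = (-1) ^ m * a ^ m * s ^ m"
        using power_mult_distrib[of "-1" "a * s" m] by (simp add: power_mult_distrib)
      ultimately show ?thesis
        by (simp add: power_mult_distrib mult_ac del: fact_Suc)
    qed
    ultimately have "(t N has_integral (\<Sum>m\<le>N. (a ^ N / (4 * 4 ^ N) *
        ((-1) ^ m / (fact (Suc m) * fact (Suc (N - m))))) * (S ^ Suc N / fact (Suc N)))) {0..S}"
      unfolding t_def by (intro has_integral_sum) auto
    also have "(\<Sum>m\<le>N. (a ^ N / (4 * 4 ^ N) *
        ((-1) ^ m / (fact (Suc m) * fact (Suc (N - m))))) * (S ^ Suc N / fact (Suc N)))
      = (\<Sum>m\<le>N. a ^ N * S ^ Suc N / (4 * 4 ^ N * fact (Suc N) * fact (Suc (Suc N))) *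
          ((-1) ^ m * real (Suc (Suc N) choose Suc m)))"
    proof (rule sum.cong, rule refl)
      fix m assume "m \<in> {..N}"
      then have "real (Suc (Suc N) choose Suc m) = fact (Suc (Suc N)) / (fact (Suc m) * fact (Suc (N - m)))"
        using binomial_fact[of "Suc m" "Suc (Suc N)", where 'a = real]
        by (simp add: Suc_diff_le del: binomial_Suc_Suc fact_Suc)
      then show "(a ^ N / (4 * 4 ^ N) * ((-1) ^ m / (fact (Suc m) * fact (Suc (N - m))))) *
          (S ^ Suc N / fact (Suc N)) = a ^ N * S ^ Suc N / (4 * 4 ^ N * fact (Suc N) * fact (Suc (Suc N))) *
          ((-1) ^ m * real (Suc (Suc N) choose Suc m))"
        by (simp add: divide_simps del: binomial_Suc_Suc fact_Suc)
    qed
    also have "\<dots> = a ^ N * S ^ Suc N * (1 + (-1) ^ N) / (4 * 4 ^ N * fact (Suc N) * fact (Suc (Suc N)))"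
      unfolding sum_distrib_left[symmetric] sum_alternating_binomial_inner by simp
    finally show ?thesis .
  qed
  have ct: "continuous_on {0..S} (t N)" for N
    unfolding t_def by (intro continuous_intros)
  obtain I J where IJ: "\<And>n. ((\<lambda>s. \<Sum>i<n. t i s) has_integral I n) {0..S}" "(?f has_integral J) {0..S}"
    "I \<longlonglongrightarrow> J"
    by (rule uniform_limit_integral[OF ul]) (auto intro!: continuous_intros ct)
  let ?u = "\<lambda>N. a ^ N * S ^ Suc N * (1 + (-1) ^ N) / (4 * 4 ^ N * fact (Suc N) * fact (Suc (Suc N)))"
  have "I n = (\<Sum>i<n. ?u i)" for n
    by (rule has_integral_unique[OF IJ(1)]) (intro has_integral_sum tN finite_lessThan)
  then have "I = (\<lambda>n. \<Sum>i<n. ?u i)"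
    by (rule ext)
  then have "?u sums J"
    using IJ(3) unfolding sums_def by (simp only:)
  moreover have "?u sums (2 / a * (bessel_entire 1 (a * S) - bessel_entire 1 (- a * S)))"
  proof -
    let ?v = "\<lambda>m. 2 / a * (?b m * (a * S) ^ m - ?b m * (- a * S) ^ m)"
    have "?v sums (2 / a * (bessel_entire 1 (a * S) - bessel_entire 1 (- a * S)))"
      by (intro sums_mult sums_diff bessel_entire_sums)
    moreover have "?v (Suc N) = ?u N" for N
    proof -
      have "(- a * S) ^ Suc N = - ((-1) ^ N * (a * S) ^ Suc N)"
        using power_mult_distrib[of "-1" "a * S" "Suc N"] by simp
      then show ?thesis
        using a by (simp add: power_mult_distrib field_simps del: fact_Suc)
    qed
    ultimately show ?thesis
      using sums_Suc_iff[of ?v] by simp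
  qed
  ultimately show ?thesis
    using IJ(2) sums_unique2 by blast
qed

section \<open>Integrals with moving limits\<close>

text \<open>The substitution \<open>y = p z + r (q z - p z)\<close> moves the integral to the fixed interval \<open>[0, 1]\<close>.\<close>

lemma continuous_on_integral_moving:
  fixes p q :: "'a::topological_space \<Rightarrow> real" and g :: "'a \<Rightarrow> real \<Rightarrow> real"
  assumes p: "continuous_on A p" and q: "continuous_on A q"
    and le: "\<And>z. z \<in> A \<Longrightarrow> p z \<le> q z"
    and g: "continuous_on {(z, y). z \<in> A \<and> p z \<le> y \<and> y \<le> q z} (\<lambda>(z, y). g z y)"
  shows "continuous_on A (\<lambda>z. integral {p z..q z} (g z))"
proof -
  have between: "p z \<le> p z + r * (q z - p z) \<and> p z + r * (q z - p z) \<le> q z"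
    if "z \<in> A" "r \<in> {0..1}" for z r
    using le[OF that(1)] that(2) mult_right_mono[of r 1 "q z - p z"] by auto
  have "integral {p z..q z} (g z) = (q z - p z) * integral {0..1} (\<lambda>r. g z (p z + r * (q z - p z)))"
    if z: "z \<in> A" for z
  proof -
    have "((\<lambda>r. (q z - p z) *\<^sub>R g z (p z + r * (q z - p z))) has_integral
        integral {p z + 0 * (q z - p z)..p z + 1 * (q z - p z)} (g z)) {0..1}"
    proof (rule has_integral_substitution)
      show "(\<lambda>r. p z + r * (q z - p z)) ` {0..1} \<subseteq> {p z..q z}"
        using between[OF z] by auto
      show "continuous_on {p z..q z} (g z)"
        by (rule continuous_on_compose2[OF g, where f = "\<lambda>y. (z, y)", simplified])
          (auto intro!: continuous_intros simp: z)
    qed (use le[OF z] in \<open>auto intro!: derivative_eq_intros\<close>)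
    then show ?thesis
      by (auto dest!: integral_unique)
  qed
  moreover have "continuous_on A (\<lambda>z. (q z - p z) *
      integral (cbox 0 1) (\<lambda>r. g z (p z + r * (q z - p z))))"
  proof (intro continuous_intros p q integral_continuous_on_param)
    have "continuous_on (A \<times> cbox 0 (1::real)) (\<lambda>z. case (fst z, p (fst z) + snd z * (q (fst z) - p (fst z)))
        of (z, y) \<Rightarrow> g z y)"
      by (rule continuous_on_compose2[OF g, where f = "\<lambda>z. (fst z, p (fst z) + snd z * (q (fst z) - p (fst z)))"])
        (auto intro!: continuous_intros continuous_on_compose2[OF p] continuous_on_compose2[OF q]
          dest: between)
    then show "continuous_on (A \<times> cbox 0 (1::real)) (\<lambda>(z, r). g z (p z + r * (q z - p z)))"
      by (simp add: case_prod_beta)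
  qed
  ultimately show ?thesis
    by (subst continuous_on_cong[OF refl]) auto
qed

text \<open>The chain rule along a graph. Only the partial derivative in the second variable has to be known and continuous
  near the curve; for integrals with a variable limit that partial derivative is the integrand.\<close>

lemma DERIV_along_curve:
  fixes f :: "real \<Rightarrow> real \<Rightarrow> real"
  assumes fx: "((\<lambda>x. f x (b x0)) has_real_derivative d) (at x0 within X)"
    and fy: "\<And>x y. x \<in> X \<Longrightarrow> y \<in> Y \<Longrightarrow> (f x has_real_derivative fy x y) (at y within Y)"
    and cont: "continuous_on (X \<times> Y) (\<lambda>(x, y). fy x y)"
    and Y: "convex Y" and b: "\<And>x. x \<in> X \<Longrightarrow> b x \<in> Y" and x0: "x0 \<in> X"
    and b': "(b has_real_derivative b') (at x0 within X)"
  shows "((\<lambda>x. f x (b x)) has_real_derivative d + fy x0 (b x0) * b') (at x0 within X)"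
proof -
  have "((\<lambda>(x, y). f x y) has_derivative (\<lambda>(tx, ty). d * tx + blinfun_mult_right (fy x0 (b x0)) ty))
      (at (x0, b x0) within X \<times> Y)"
  proof (rule has_derivative_partialsI)
    show "((\<lambda>x. f x (b x0)) has_derivative (*) d) (at x0 within X)"
      using fx by (simp add: has_field_derivative_def)
    show "(f x has_derivative blinfun_apply (blinfun_mult_right (fy x y))) (at y within Y)"
      if "x \<in> X" "y \<in> Y" for x y
      using fy[OF that] by (simp add: has_field_derivative_def)
    have "continuous_on (X \<times> Y) (\<lambda>z. blinfun_mult_right (case z of (x, y) \<Rightarrow> fy x y))"
      by (intro bounded_linear.continuous_on[OF bounded_linear_blinfun_mult_right] cont)
    then show "continuous (at (x0, b x0) within X \<times> Y) (\<lambda>(x, y). blinfun_mult_right (fy x y))"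
      using x0 b by (auto simp: continuous_on_eq_continuous_within case_prod_beta')
  qed (use Y b x0 in auto)
  then have D: "((\<lambda>(x, y). f x y) has_derivative (\<lambda>(tx, ty). d * tx + blinfun_mult_right (fy x0 (b x0)) ty))
      (at (x0, b x0) within (\<lambda>x. (x, b x)) ` X)"
    by (rule has_derivative_subset) (use b in auto)
  have "((\<lambda>x. (x, b x)) has_derivative (\<lambda>h. (h, b' * h))) (at x0 within X)"
    using b' by (auto intro!: derivative_eq_intros simp: has_field_derivative_def)
  from has_derivative_in_compose[OF this D]
  have "((\<lambda>x. f x (b x)) has_derivative (\<lambda>h. d * h + fy x0 (b x0) * (b' * h))) (at x0 within X)"
    by simp
  then show ?thesis
    unfolding has_field_derivative_def by (rule has_derivative_eq_rhs) (auto simp: algebra_simps)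
qed

lemma DERIV_integral_kernel:
  fixes f :: "real \<Rightarrow> real" and k kx :: "real \<Rightarrow> real \<Rightarrow> real"
  assumes f: "continuous_on {A..B} f"
    and k: "continuous_on UNIV (\<lambda>(x, y). k x y)" and kx: "continuous_on UNIV (\<lambda>(x, y). kx x y)"
    and k': "\<And>x y. ((\<lambda>x. k x y) has_real_derivative kx x y) (at x)"
    and x: "x \<in> {A..B}"
  shows "((\<lambda>x. integral {x..B} (\<lambda>y. k x y * f y)) has_real_derivative
    integral {x..B} (\<lambda>y. kx x y * f y) - k x x * f x) (at x within {A..B})"
proof -
  note [continuous_intros] = continuous_on_compose2[OF k, where f = "\<lambda>z. (_ z, _ z)", simplified]
    continuous_on_compose2[OF kx, where f = "\<lambda>z. (_ z, _ z)", simplified]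
  have "((\<lambda>x. integral {x..B} (\<lambda>y. k x y * f y)) has_real_derivative
    integral {x..B} (\<lambda>y. kx x y * f y) + (\<lambda>x b. - (k x b * f b)) x x * 1) (at x within {A..B})"
  proof (rule DERIV_along_curve[where b = "\<lambda>x. x" and f = "\<lambda>x b. integral {b..B} (\<lambda>y. k x y * f y)"
        and Y = "{A..B}" and fy = "\<lambda>x b. - (k x b * f b)"])
    have c: "continuous_on {x..B} f"
      by (rule continuous_on_subset[OF f]) (use x in auto)
    have c': "continuous_on ({A..B} \<times> {x..B}) (\<lambda>z. f (snd z))"
      by (rule continuous_on_compose2[OF c]) (auto intro!: continuous_intros)
    show "((\<lambda>x'. integral {x..B} (\<lambda>y. k x' y * f y)) has_real_derivative
        integral {x..B} (\<lambda>y. kx x y * f y)) (at x within {A..B})"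
    proof (rule leibniz_rule_field_derivative[of "{A..B}" x B "\<lambda>x y. k x y * f y" "\<lambda>x y. kx x y * f y",
          unfolded cbox_interval])
      show "((\<lambda>x. k x y * f y) has_real_derivative kx x' y * f y) (at x' within {A..B})" for x' y
        by (rule DERIV_cmult_right) (rule has_field_derivative_at_within[OF k'])
      show "(\<lambda>y. k x' y * f y) integrable_on {x..B}" for x'
        by (intro integrable_continuous_real continuous_intros c)
      show "continuous_on ({A..B} \<times> {x..B}) (\<lambda>(x', y). kx x' y * f y)"
        unfolding case_prod_beta by (intro continuous_intros c')
    qed (use x in auto)
    show "((\<lambda>b. integral {b..B} (\<lambda>y. k x y * f y)) has_real_derivative - (k x b * f b)) (at b within {A..B})"
      if "b \<in> {A..B}" for x b
      by (rule integral_has_real_derivative') (intro continuous_intros f that)+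
    show "continuous_on ({A..B} \<times> {A..B}) (\<lambda>(x, b). - (k x b * f b))"
      unfolding case_prod_beta
      by (intro continuous_intros continuous_on_compose2[OF f]) auto
  qed (use x in auto)
  then show ?thesis by simp
qed

text \<open>For limits kept at distance \<open>d > 0\<close> from the two ends, the integral of \<open>u\<close> can be differentiated
  under the integral sign, and the fundamental theorem of calculus turns the integral of \<open>u\<^sub>t = P\<^sub>x\<close>
  into values of \<open>P\<close>. The resulting derivative \<open>R d t\<close> contains only \<open>u\<close> and \<open>P\<close>, which are continuous up
  to the boundary, so it converges as \<open>d \<rightarrow> 0\<close> uniformly on compact time intervals.\<close>

lemma DERIV_integral_conservation_law_sourceless:
  fixes u P ut :: "real \<Rightarrow> real \<Rightarrow> real" and H H' :: "real \<Rightarrow> real"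
  assumes J: "open J" "t0 \<in> J"
    and H: "\<And>t. t \<in> J \<Longrightarrow> (H has_real_derivative H' t) (at t)" "continuous_on J H'"
      "\<And>t. t \<in> J \<Longrightarrow> \<alpha> < H t"
    and u: "continuous_on {(y, t). t \<in> J \<and> \<alpha> \<le> y \<and> y \<le> H t} (\<lambda>(y, t). u y t)"
    and P: "continuous_on {(y, t). t \<in> J \<and> \<alpha> \<le> y \<and> y \<le> H t} (\<lambda>(y, t). P y t)"
    and ut: "continuous_on {(y, t). t \<in> J \<and> \<alpha> < y \<and> y < H t} (\<lambda>(y, t). ut y t)"
    and u': "\<And>y t. t \<in> J \<Longrightarrow> \<alpha> < y \<Longrightarrow> y < H t \<Longrightarrow> (u y has_real_derivative ut y t) (at t)"
    and P': "\<And>y t. t \<in> J \<Longrightarrow> \<alpha> < y \<Longrightarrow> y < H t \<Longrightarrow> ((\<lambda>y. P y t) has_real_derivative ut y t) (at y)"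
  shows "((\<lambda>t. integral {\<alpha>..H t} (\<lambda>y. u y t)) has_real_derivative
    H' t0 * u (H t0) t0 + P (H t0) t0 - P \<alpha> t0) (at t0)"
proof -
  have contH: "continuous_on J H"
    using H(1) by (meson DERIV_continuous_on has_field_derivative_at_within)
  obtain e where e: "e > 0" "cball t0 e \<subseteq> J"
    using J open_contains_cball by blast
  define K where "K = {t0 - e..t0 + e}"
  have KJ: "K \<subseteq> J"
    using e by (auto simp: K_def cball_eq_atLeastAtMost)
  obtain tm where tm: "tm \<in> K" "\<And>t. t \<in> K \<Longrightarrow> H tm \<le> H t"
    using continuous_attains_inf[of K H] continuous_on_subset[OF contH KJ] e(1) by (auto simp: K_def)
  define m where "m = (H tm - \<alpha>) / 2"
  have m: "m > 0"
    using H(3)[of tm] tm(1) KJ by (auto simp: m_def)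
  have mH: "\<alpha> + d \<le> H t - d" if "t \<in> K" "d \<le> m" for d t
    using tm(2)[OF that(1)] that(2) by (simp add: m_def)
  have mH': "\<alpha> + d \<le> H t" if "t \<in> K" "0 \<le> d" "d \<le> m" for d t
    using mH[OF that(1,3)] that(2) by linarith
  define G where "G d t = integral {\<alpha> + d..H t - d} (\<lambda>y. u y t)" for d t
  define R where "R d t = H' t * u (H t - d) t + P (H t - d) t - P (\<alpha> + d) t" for d t
  have contu: "continuous_on A (\<lambda>z. u (f z) (g z))"
    if "continuous_on A f" "continuous_on A g" "\<And>z. z \<in> A \<Longrightarrow> g z \<in> J \<and> \<alpha> \<le> f z \<and> f z \<le> H (g z)"
    for A and f g :: "'b::topological_space \<Rightarrow> real"
    using continuous_on_compose2[OF u continuous_on_Pair[OF that(1,2)]] that(3) by auto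
  have contP: "continuous_on A (\<lambda>z. P (f z) (g z))"
    if "continuous_on A f" "continuous_on A g" "\<And>z. z \<in> A \<Longrightarrow> g z \<in> J \<and> \<alpha> \<le> f z \<and> f z \<le> H (g z)"
    for A and f g :: "'b::topological_space \<Rightarrow> real"
    using continuous_on_compose2[OF P continuous_on_Pair[OF that(1,2)]] that(3) by auto
  \<comment> \<open>The factor \<open>2\<close> leaves room for the upper limit to move by \<open>d / 2\<close> without crossing the lower one.\<close>
  have G': "(G d has_real_derivative R d t) (at t)" if d: "0 < d" "2 * d \<le> m" and t: "t \<in> K" for d t
  proof -
    have tJ: "t \<in> J" using t KJ by auto
    define b where "b = H t - d"
    have b: "\<alpha> + d + d \<le> b" using mH[OF t, of "d"] tm(2)[OF t] d by (simp add: b_def m_def)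
    have "open (J \<inter> H -` {H t - d / 2<..<H t + d / 2})"
      using contH J(1) by (rule continuous_open_preimage[OF _ _ open_greaterThanLessThan])
    moreover have "t \<in> J \<inter> H -` {H t - d / 2<..<H t + d / 2}" using tJ d by auto
    ultimately obtain r where r: "r > 0" "ball t r \<subseteq> J \<inter> H -` {H t - d / 2<..<H t + d / 2}"
      using open_contains_ball by blast
    define U where "U = ball t r"
    have UJ: "U \<subseteq> J"
      using r by (auto simp: U_def)
    have UH: "H t - d / 2 < H s" "H s < H t + d / 2" if "s \<in> U" for s
      using r(2) that by (auto simp: U_def subset_iff)
    have tU: "t \<in> U" "open U" "convex U" using r by (auto simp: U_def)
    define Y where "Y = {\<alpha> + d..b + d / 2}"
    have reg: "\<alpha> < y \<and> y < H s" if "s \<in> U" "y \<in> Y" for s y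
      using that UH[OF that(1)] d(1) by (auto simp: Y_def b_def)
    have cuY: "continuous_on Y (\<lambda>y. u y s)" if "s \<in> U" for s
      by (rule contu) (use that reg UJ in \<open>auto intro!: continuous_intros less_imp_le\<close>)
    have "((\<lambda>t. integral {\<alpha> + d..H t - d} (\<lambda>y. u y t)) has_real_derivative
        (P b t - P (\<alpha> + d) t) + (\<lambda>t y. u y t) t (H t - d) * H' t) (at t within U)"
    proof (rule DERIV_along_curve[where Y = Y and b = "\<lambda>t. H t - d"])
      have bY: "{\<alpha> + d..b} \<subseteq> Y"
        using d b by (auto simp: Y_def)
      have "((\<lambda>s. integral (cbox (\<alpha> + d) b) (\<lambda>y. u y s)) has_real_derivative
          integral (cbox (\<alpha> + d) b) (\<lambda>y. ut y t)) (at t within U)"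
      proof (rule leibniz_rule_field_derivative)
        show "(u y has_real_derivative ut y s) (at s within U)" if "s \<in> U" "y \<in> cbox (\<alpha> + d) b" for s y
          using reg[OF that(1), of y] that bY UJ
          by (intro has_field_derivative_at_within[OF u']) auto
        show "(\<lambda>y. u y s) integrable_on cbox (\<alpha> + d) b" if "s \<in> U" for s
          unfolding cbox_interval
          by (intro integrable_continuous_real continuous_on_subset[OF cuY[OF that] bY])
        have "continuous_on (U \<times> cbox (\<alpha> + d) b) (\<lambda>z. case (snd z, fst z) of (y, t) \<Rightarrow> ut y t)"
          by (rule continuous_on_compose2[OF ut])
            (use bY UJ reg in \<open>auto intro!: continuous_intros simp: subset_iff\<close>)
        then show "continuous_on (U \<times> cbox (\<alpha> + d) b) (\<lambda>(s, y). ut y s)"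
          by (simp add: case_prod_beta')
      qed (use tU in auto)
      moreover have "((\<lambda>y. ut y t) has_integral P b t - P (\<alpha> + d) t) {\<alpha> + d..b}"
        using b d(1) bY reg[OF tU(1)] tJ
        by (intro fundamental_theorem_of_calculus)
          (auto simp: has_real_derivative_iff_has_vector_derivative[symmetric] subset_iff
            intro!: has_field_derivative_at_within[OF P'])
      ultimately show "((\<lambda>s. integral {\<alpha> + d..H t - d} (\<lambda>y. u y s)) has_real_derivative
          P b t - P (\<alpha> + d) t) (at t within U)"
        by (simp add: integral_unique b_def)
      show "((\<lambda>y. integral {\<alpha> + d..y} (\<lambda>y. u y s)) has_real_derivative u y s) (at y within Y)"
        if "s \<in> U" "y \<in> Y" for s y
        unfolding Y_def
        by (rule integral_has_real_derivative) (use cuY[OF that(1)] that(2) in \<open>auto simp: Y_def\<close>)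
      show "continuous_on (U \<times> Y) (\<lambda>(s, y). u y s)"
        unfolding case_prod_beta'
        by (rule contu) (use reg UJ in \<open>auto intro!: continuous_intros less_imp_le\<close>)
      show "H s - d \<in> Y" if "s \<in> U" for s
        using UH[OF that] b d(1) by (simp add: Y_def b_def)
      show "((\<lambda>t. H t - d) has_real_derivative H' t) (at t within U)"
        using has_field_derivative_at_within[OF H(1)[OF tJ]] by (auto intro!: derivative_eq_intros)
    qed (use tU in \<open>auto simp: Y_def\<close>)
    then show ?thesis
      using at_within_open[OF tU(1,2)]
      by (simp add: G_def[abs_def] R_def b_def algebra_simps)
  qed
  have contR: "continuous_on ({0..m} \<times> K) (\<lambda>(d, t). R d t)"
    unfolding R_def case_prod_beta'
    by (intro continuous_intros contu contP continuous_on_compose2[OF contH] continuous_on_compose2[OF H(2)])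
      (use KJ mH mH' m in \<open>auto simp: algebra_simps subset_iff\<close>)
  then have uR: "uniformly_continuous_on ({0..m} \<times> K) (\<lambda>(d, t). R d t)"
    by (intro compact_uniformly_continuous compact_Times) (auto simp: K_def)
  have contG: "continuous_on {0..m} (\<lambda>d. G d t)" if t: "t \<in> K" for t
    unfolding G_def
  proof (rule continuous_on_integral_moving)
    show "continuous_on {(z, y). z \<in> {0..m} \<and> \<alpha> + z \<le> y \<and> y \<le> H t - z} (\<lambda>(z, y). u y t)"
      unfolding case_prod_beta'
      by (rule contu) (use t KJ in \<open>auto intro!: continuous_intros\<close>)
  qed (use mH[OF t] in \<open>auto intro!: continuous_intros\<close>)
  define \<delta> where "\<delta> n = m / (real n + 2)" for n
  have \<delta>: "0 < \<delta> n" "2 * \<delta> n \<le> m" "\<delta> n \<in> {0..m}" for n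
    using m by (auto simp: \<delta>_def field_simps)
  have \<delta>0: "\<delta> \<longlonglongrightarrow> 0"
    using LIMSEQ_ignore_initial_segment[OF lim_const_over_n[of m], of 2]
    by (simp add: \<delta>_def[abs_def] add.commute)
  have "\<exists>g. \<forall>t\<in>K. (\<lambda>n. G (\<delta> n) t) \<longlonglongrightarrow> g t \<and> (g has_derivative (*) (R 0 t)) (at t within K)"
  proof (rule has_derivative_sequence[where f' = "\<lambda>n t. (*) (R (\<delta> n) t)"])
    show "(G (\<delta> n) has_derivative (*) (R (\<delta> n) t)) (at t within K)" if "t \<in> K" for n t
      using has_field_derivative_at_within[OF G'[OF \<delta>(1,2) that]] by (simp add: has_field_derivative_def)
    show "\<forall>\<^sub>F n in sequentially. \<forall>t\<in>K. \<forall>h. norm (R (\<delta> n) t * h - R 0 t * h) \<le> \<epsilon> * norm h" if "\<epsilon> > 0" for \<epsilon>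
    proof -
      obtain \<eta> where \<eta>: "\<eta> > 0" "\<And>z z'. z \<in> {0..m} \<times> K \<Longrightarrow> z' \<in> {0..m} \<times> K \<Longrightarrow> dist z' z < \<eta> \<Longrightarrow>
          dist (case z' of (d, t) \<Rightarrow> R d t) (case z of (d, t) \<Rightarrow> R d t) < \<epsilon>"
        using uR \<open>\<epsilon> > 0\<close> unfolding uniformly_continuous_on_def by metis
      have "\<forall>\<^sub>F n in sequentially. dist (\<delta> n) 0 < \<eta>"
        using \<delta>0 \<eta>(1) by (rule tendstoD)
      then show ?thesis
      proof eventually_elim
        case (elim n)
        have "\<bar>R (\<delta> n) t - R 0 t\<bar> \<le> \<epsilon>" if "t \<in> K" for t
          using \<eta>(2)[of "(0, t)" "(\<delta> n, t)"] that \<delta>(3) m elim by (auto simp: dist_Pair_Pair dist_real_def)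
        then show ?case
          by (auto simp: left_diff_distrib[symmetric] abs_mult intro!: mult_right_mono)
      qed
    qed
    show "(\<lambda>n. G (\<delta> n) t0) \<longlonglongrightarrow> G 0 t0"
      using contG[of t0] \<delta>0 \<delta>(3) e(1) m
      by (intro continuous_on_tendsto_compose[OF contG]) (auto simp: K_def)
  qed (use e in \<open>auto simp: K_def\<close>)
  then obtain g where g: "\<And>t. t \<in> K \<Longrightarrow> (\<lambda>n. G (\<delta> n) t) \<longlonglongrightarrow> g t"
    "\<And>t. t \<in> K \<Longrightarrow> (g has_derivative (*) (R 0 t)) (at t within K)" by blast
  have "(\<lambda>n. G (\<delta> n) t) \<longlonglongrightarrow> G 0 t" if "t \<in> K" for t
    using \<delta>0 \<delta>(3) m that
    by (intro continuous_on_tendsto_compose[OF contG]) auto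
  then have gG: "g t = G 0 t" if "t \<in> K" for t
    using g(1) that LIMSEQ_unique by blast
  have t0: "t0 \<in> K" "t0 \<in> interior K"
    using e(1) by (auto simp: K_def)
  have "(g has_real_derivative R 0 t0) (at t0)"
    using g(2)[OF t0(1)] at_within_interior[OF t0(2)] by (simp add: has_field_derivative_def)
  then have "(G 0 has_real_derivative R 0 t0) (at t0)"
    by (rule has_field_derivative_transform_within_open[OF _ open_interior t0(2)])
      (use gG interior_subset in blast)
  then show ?thesis
    by (simp add: G_def[abs_def] R_def)
qed

text \<open>A source \<open>S\<close> that is continuous up to the boundary is absorbed into the flux by adding its primitive in space.\<close>

lemma DERIV_integral_conservation_law:
  fixes u P S ut :: "real \<Rightarrow> real \<Rightarrow> real" and H H' :: "real \<Rightarrow> real"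
  assumes J: "open J" "t0 \<in> J"
    and H: "\<And>t. t \<in> J \<Longrightarrow> (H has_real_derivative H' t) (at t)" "continuous_on J H'"
      "\<And>t. t \<in> J \<Longrightarrow> \<alpha> < H t"
    and u: "continuous_on {(y, t). t \<in> J \<and> \<alpha> \<le> y \<and> y \<le> H t} (\<lambda>(y, t). u y t)"
    and P: "continuous_on {(y, t). t \<in> J \<and> \<alpha> \<le> y \<and> y \<le> H t} (\<lambda>(y, t). P y t)"
    and S: "continuous_on {(y, t). t \<in> J \<and> \<alpha> \<le> y \<and> y \<le> H t} (\<lambda>(y, t). S y t)"
    and ut: "continuous_on {(y, t). t \<in> J \<and> \<alpha> < y \<and> y < H t} (\<lambda>(y, t). ut y t)"
    and u': "\<And>y t. t \<in> J \<Longrightarrow> \<alpha> < y \<Longrightarrow> y < H t \<Longrightarrow> (u y has_real_derivative ut y t) (at t)"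
    and P': "\<And>y t. t \<in> J \<Longrightarrow> \<alpha> < y \<Longrightarrow> y < H t \<Longrightarrow>
      ((\<lambda>y. P y t) has_real_derivative ut y t - S y t) (at y)"
  shows "((\<lambda>t. integral {\<alpha>..H t} (\<lambda>y. u y t)) has_real_derivative
    H' t0 * u (H t0) t0 + P (H t0) t0 - P \<alpha> t0 + integral {\<alpha>..H t0} (\<lambda>y. S y t0)) (at t0)"
proof -
  let ?R = "{(y, t). t \<in> J \<and> \<alpha> \<le> y \<and> y \<le> H t}"
  define Q where "Q y t = P y t + integral {\<alpha>..y} (\<lambda>y. S y t)" for y t
  have contS: "continuous_on A (\<lambda>z. S (f z) (g z))"
    if "continuous_on A f" "continuous_on A g" "\<And>z. z \<in> A \<Longrightarrow> g z \<in> J \<and> \<alpha> \<le> f z \<and> f z \<le> H (g z)"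
    for A and f g :: "'b::topological_space \<Rightarrow> real"
    using continuous_on_compose2[OF S continuous_on_Pair[OF that(1,2)]] that(3) by auto
  have "((\<lambda>t. integral {\<alpha>..H t} (\<lambda>y. u y t)) has_real_derivative
    H' t0 * u (H t0) t0 + Q (H t0) t0 - Q \<alpha> t0) (at t0)"
  proof (rule DERIV_integral_conservation_law_sourceless[OF J H u _ ut u'])
    have "continuous_on ?R (\<lambda>z. integral {\<alpha>..fst z} (\<lambda>y. S y (snd z)))"
    proof (rule continuous_on_integral_moving)
      show "continuous_on {(z, y). z \<in> ?R \<and> \<alpha> \<le> y \<and> y \<le> fst z} (\<lambda>(z, y). S y (snd z))"
        unfolding case_prod_beta' by (rule contS) (auto intro!: continuous_intros)
    qed (auto intro!: continuous_intros)
    then show "continuous_on ?R (\<lambda>(y, t). Q y t)"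
      unfolding Q_def using P by (auto intro!: continuous_intros simp: case_prod_beta')
    fix y t assume t: "t \<in> J" "\<alpha> < y" "y < H t"
    have "((\<lambda>y. integral {\<alpha>..y} (\<lambda>y. S y t)) has_real_derivative S y t) (at y within {\<alpha>..H t})"
      by (rule integral_has_real_derivative) (use t in \<open>auto intro!: contS continuous_intros\<close>)
    then have "((\<lambda>y. integral {\<alpha>..y} (\<lambda>y. S y t)) has_real_derivative S y t) (at y)"
      using t at_within_Icc_at[of \<alpha> y "H t"] by simp
    from DERIV_add[OF P'[OF t] this]
    show "((\<lambda>y. Q y t) has_real_derivative ut y t) (at y)"
      by (simp add: Q_def)
  qed
  then show ?thesis by (simp add: Q_def algebra_simps)
qed

section \<open>The backstepping kernel\<close>

text \<open>For \<open>0 \<le> x \<le> y\<close> the argument of the series is at most zero, so this is \<open>a x J\<^sub>1(\<zeta>) / \<zeta>\<close> with \<open>\<zeta> = sqrt (a (y\<^sup>2 - x\<^sup>2))\<close>. The four functions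
  defined next are its partial derivatives.\<close>

definition obs_kernel :: "real \<Rightarrow> real \<Rightarrow> real \<Rightarrow> real" where
  "obs_kernel a x y = a * x * bessel_entire 1 (a * (x\<^sup>2 - y\<^sup>2))"

definition obs_kernel_x :: "real \<Rightarrow> real \<Rightarrow> real \<Rightarrow> real" where
  "obs_kernel_x a x y = a * bessel_entire 1 (a * (x\<^sup>2 - y\<^sup>2)) + a\<^sup>2 * x\<^sup>2 * bessel_entire 2 (a * (x\<^sup>2 - y\<^sup>2))"

definition obs_kernel_xx :: "real \<Rightarrow> real \<Rightarrow> real \<Rightarrow> real" where
  "obs_kernel_xx a x y = 3 * a\<^sup>2 * x * bessel_entire 2 (a * (x\<^sup>2 - y\<^sup>2))
    + a ^ 3 * x ^ 3 * bessel_entire 3 (a * (x\<^sup>2 - y\<^sup>2))"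

definition obs_kernel_y :: "real \<Rightarrow> real \<Rightarrow> real \<Rightarrow> real" where
  "obs_kernel_y a x y = - (a\<^sup>2 * x * y * bessel_entire 2 (a * (x\<^sup>2 - y\<^sup>2)))"

definition obs_kernel_yy :: "real \<Rightarrow> real \<Rightarrow> real \<Rightarrow> real" where
  "obs_kernel_yy a x y = a ^ 3 * x * y\<^sup>2 * bessel_entire 3 (a * (x\<^sup>2 - y\<^sup>2))
    - a\<^sup>2 * x * bessel_entire 2 (a * (x\<^sup>2 - y\<^sup>2))"

lemma DERIV_bessel_entire_numeral:
  "(bessel_entire 1 has_real_derivative bessel_entire 2 s / 2) (at s)"
  "(bessel_entire 2 has_real_derivative bessel_entire 3 s / 2) (at s)"
  using DERIV_bessel_entire[of 1 s] DERIV_bessel_entire[of 2 s] by (simp_all add: numeral_eq_Suc)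

lemmas DERIV_bessel_entire_numeral_chain = DERIV_bessel_entire_numeral[THEN DERIV_chain2]

lemma DERIV_obs_kernel:
  "((\<lambda>x. obs_kernel a x y) has_real_derivative obs_kernel_x a x y) (at x)"
  "((\<lambda>x. obs_kernel_x a x y) has_real_derivative obs_kernel_xx a x y) (at x)"
  "((\<lambda>y. obs_kernel a x y) has_real_derivative obs_kernel_y a x y) (at y)"
  "((\<lambda>y. obs_kernel_y a x y) has_real_derivative obs_kernel_yy a x y) (at y)"
  unfolding obs_kernel_def obs_kernel_x_def obs_kernel_xx_def obs_kernel_y_def obs_kernel_yy_def
  by (auto intro!: derivative_eq_intros DERIV_bessel_entire_numeral_chain
      simp del: One_nat_def simp: field_simps power2_eq_square power3_eq_cube)

lemma continuous_on_obs_kernel [continuous_intros]: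
  assumes "continuous_on A f" "continuous_on A g"
  shows "continuous_on A (\<lambda>z. obs_kernel a (f z) (g z))"
    "continuous_on A (\<lambda>z. obs_kernel_x a (f z) (g z))"
    "continuous_on A (\<lambda>z. obs_kernel_xx a (f z) (g z))"
    "continuous_on A (\<lambda>z. obs_kernel_y a (f z) (g z))"
    "continuous_on A (\<lambda>z. obs_kernel_yy a (f z) (g z))"
  unfolding obs_kernel_def obs_kernel_x_def obs_kernel_xx_def obs_kernel_y_def obs_kernel_yy_def
  by (intro continuous_intros assms)+

lemma obs_kernel_wave_equation:
  "obs_kernel_xx a x y - obs_kernel_yy a x y = a * obs_kernel a x y"
proof -
  have "bessel_entire 1 s = 4 * bessel_entire 2 s + s * bessel_entire 3 s" for s
    using bessel_entire_recurrence[of 1 s] by (simp add: numeral_eq_Suc)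
  then show ?thesis
    by (simp add: obs_kernel_def obs_kernel_xx_def obs_kernel_yy_def algebra_simps
        power2_eq_square power3_eq_cube)
qed

lemma bessel_entire_at_0:
  "bessel_entire 1 0 = 1 / 2" "bessel_entire 2 0 = 1 / 8"
  using bessel_entire_0[of 1] bessel_entire_0[of 2] by (simp_all add: numeral_eq_Suc)

lemma obs_kernel_diagonal:
  "obs_kernel a x x = a * x / 2"
  "obs_kernel_x a x x = a / 2 + a\<^sup>2 * x\<^sup>2 / 8"
  "obs_kernel_y a x x = - (a\<^sup>2 * x\<^sup>2 / 8)"
  by (simp_all add: obs_kernel_def obs_kernel_x_def obs_kernel_y_def bessel_entire_at_0
      power2_eq_square del: One_nat_def)

lemma obs_kernel_0 [simp]: "obs_kernel a 0 y = 0"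
  by (simp add: obs_kernel_def)

text \<open>The substitution \<open>s = y\<^sup>2 - x\<^sup>2\<close> reduces this to \<open>bessel_entire_convolution\<close>. It is the identity that
  cancels all terms proportional to \<open>c\<close> in the equation for the transformed temperature.\<close>

lemma obs_kernel_resolvent:
  assumes a: "a > 0" and x: "0 \<le> x" "x \<le> h"
  shows "((\<lambda>y. obs_kernel a x y * (a * y * bessel_entire 1 (a * (h\<^sup>2 - y\<^sup>2)))) has_integral
    a * x * bessel_entire 1 (a * (h\<^sup>2 - x\<^sup>2)) - obs_kernel a x h) {x..h}"
proof -
  define S where "S = h\<^sup>2 - x\<^sup>2"
  have S: "0 \<le> S" using x by (simp add: S_def)
  define f where "f s = bessel_entire 1 (- a * s) * bessel_entire 1 (a * (S - s))" for s
  have "((\<lambda>y. (2 * y) *\<^sub>R f (y\<^sup>2 - x\<^sup>2)) has_integral integral {x\<^sup>2 - x\<^sup>2..h\<^sup>2 - x\<^sup>2} f) {x..h}"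
  proof (rule has_integral_substitution)
    show "(\<lambda>y. y\<^sup>2 - x\<^sup>2) ` {x..h} \<subseteq> {0..S}"
      using x by (auto simp: S_def intro!: power_mono)
    show "continuous_on {0..S} f"
      unfolding f_def by (intro continuous_intros)
  qed (use x S in \<open>auto simp: S_def intro!: derivative_eq_intros\<close>)
  moreover have "integral {x\<^sup>2 - x\<^sup>2..h\<^sup>2 - x\<^sup>2} f = 2 / a * (bessel_entire 1 (a * S) - bessel_entire 1 (- a * S))"
    using bessel_entire_convolution[OF S, of a] a
    by (simp add: f_def[abs_def] S_def integral_unique)
  ultimately have "((\<lambda>y. a\<^sup>2 * x / 2 * ((2 * y) * f (y\<^sup>2 - x\<^sup>2))) has_integral
      a\<^sup>2 * x / 2 * (2 / a * (bessel_entire 1 (a * S) - bessel_entire 1 (- a * S)))) {x..h}"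
    by (intro has_integral_mult_right) simp
  moreover have "a\<^sup>2 * x / 2 * ((2 * y) * f (y\<^sup>2 - x\<^sup>2))
      = obs_kernel a x y * (a * y * bessel_entire 1 (a * (h\<^sup>2 - y\<^sup>2)))" for y
  proof -
    have "- a * (y\<^sup>2 - x\<^sup>2) = a * (x\<^sup>2 - y\<^sup>2)" "S - (y\<^sup>2 - x\<^sup>2) = h\<^sup>2 - y\<^sup>2"
      by (simp_all add: S_def algebra_simps)
    then show ?thesis
      unfolding f_def obs_kernel_def by (simp only:) (simp add: power2_eq_square)
  qed
  moreover have "a\<^sup>2 * x / 2 * (2 / a * (bessel_entire 1 (a * S) - bessel_entire 1 (- a * S)))
      = a * x * bessel_entire 1 (a * (h\<^sup>2 - x\<^sup>2)) - obs_kernel a x h"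
  proof -
    have "- a * S = a * (x\<^sup>2 - h\<^sup>2)" by (simp add: S_def algebra_simps)
    then show ?thesis
      unfolding obs_kernel_def using a
      by (simp only:) (simp add: S_def power2_eq_square field_simps)
  qed
  ultimately show ?thesis by (simp only:)
qed

section \<open>Volterra operators in the square norm\<close>

text \<open>The integral of \<open>(f - s)\<^sup>2\<close> is nonnegative; take the mean value of \<open>f\<close> for \<open>s\<close>.\<close>

lemma integral_square_le_length_times:
  fixes f :: "real \<Rightarrow> real"
  assumes f: "continuous_on {a..b} f" and ab: "a \<le> b"
  shows "(integral {a..b} f)\<^sup>2 \<le> (b - a) * integral {a..b} (\<lambda>x. (f x)\<^sup>2)"
proof (cases "a = b")
  case False
  define I where "I = integral {a..b} f"
  define s where "s = I / (b - a)"
  have "((\<lambda>x. (f x)\<^sup>2 - 2 * s * f x + s\<^sup>2) has_integral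
      integral {a..b} (\<lambda>x. (f x)\<^sup>2) - 2 * s * I + (b - a) *\<^sub>R s\<^sup>2) {a..b}"
    unfolding I_def
    by (intro has_integral_add has_integral_diff has_integral_mult_right integrable_integral
        integrable_continuous_real continuous_intros f)
      (use has_integral_const_real[of "s\<^sup>2" a b] ab in simp)
  moreover have "0 \<le> (f x)\<^sup>2 - 2 * s * f x + s\<^sup>2" for x
    using zero_le_power2[of "f x - s"] by (simp add: power2_diff algebra_simps)
  ultimately have "0 \<le> integral {a..b} (\<lambda>x. (f x)\<^sup>2) - 2 * s * I + (b - a) *\<^sub>R s\<^sup>2"
    by (rule has_integral_nonneg)
  moreover have sd: "s * (b - a) = I"
    using ab False by (simp add: s_def)
  moreover have "(b - a) *\<^sub>R s\<^sup>2 = s * I"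
    by (simp add: sd[symmetric] power2_eq_square)
  ultimately have "s * I \<le> integral {a..b} (\<lambda>x. (f x)\<^sup>2)"
    by (simp add: mult.commute)
  then have "(b - a) * (s * I) \<le> (b - a) * integral {a..b} (\<lambda>x. (f x)\<^sup>2)"
    using ab by (intro mult_left_mono) auto
  moreover have "(b - a) * (s * I) = I\<^sup>2"
    using sd by (simp add: power2_eq_square mult_ac)
  ultimately show ?thesis
    by (simp add: I_def)
qed simp

lemma Volterra_square_bound:
  fixes f :: "real \<Rightarrow> real" and k :: "real \<Rightarrow> real \<Rightarrow> real"
  assumes f: "continuous_on {0..h} f" and x: "x \<in> {0..h}"
    and k: "continuous_on {x..h} (k x)" and R: "\<And>y. y \<in> {x..h} \<Longrightarrow> \<bar>k x y\<bar> \<le> R"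
  shows "(integral {x..h} (\<lambda>y. k x y * f y))\<^sup>2 \<le> R\<^sup>2 * h * integral {x..h} (\<lambda>y. (f y)\<^sup>2)"
proof -
  have f': "continuous_on {x..h} f"
    by (rule continuous_on_subset[OF f]) (use x in auto)
  have "(integral {x..h} (\<lambda>y. k x y * f y))\<^sup>2 \<le> (h - x) * integral {x..h} (\<lambda>y. (k x y * f y)\<^sup>2)"
    by (rule integral_square_le_length_times) (use x in \<open>auto intro!: continuous_intros k f'\<close>)
  also have "\<dots> \<le> h * integral {x..h} (\<lambda>y. R\<^sup>2 * (f y)\<^sup>2)"
  proof (intro mult_mono integral_le integrable_continuous_real continuous_intros k f')
    show "(k x y * f y)\<^sup>2 \<le> R\<^sup>2 * (f y)\<^sup>2" if "y \<in> {x..h}" for y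
    proof -
      have "(k x y)\<^sup>2 \<le> R\<^sup>2"
        using power_mono[OF R[OF that] abs_ge_zero, of 2] by simp
      then show ?thesis
        by (simp add: power_mult_distrib mult_right_mono)
    qed
  qed (use x in \<open>auto intro!: integral_nonneg integrable_continuous_real continuous_intros k f'\<close>)
  finally show ?thesis by (simp add: mult_ac)
qed

text \<open>The first bound is direct. For the second, the tail \<open>Y x\<close> of the integral of \<open>f\<^sup>2\<close> satisfies
  \<open>- Y' \<le> 2 g\<^sup>2 + \<kappa> Y\<close>, so Gronwall's argument applies from the right end point, and no inverse kernel has to
  be known.\<close>

lemma Volterra_transform_L2_bounds:
  fixes f g :: "real \<Rightarrow> real" and k :: "real \<Rightarrow> real \<Rightarrow> real"
  assumes h: "0 \<le> h" and f: "continuous_on {0..h} f" and g: "continuous_on {0..h} g"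
    and k: "\<And>x. x \<in> {0..h} \<Longrightarrow> continuous_on {x..h} (k x)"
    and R: "\<And>x y. 0 \<le> x \<Longrightarrow> x \<le> y \<Longrightarrow> y \<le> h \<Longrightarrow> \<bar>k x y\<bar> \<le> R"
    and eq: "\<And>x. x \<in> {0..h} \<Longrightarrow> g x = f x - integral {x..h} (\<lambda>y. k x y * f y)"
  shows "integral {0..h} (\<lambda>x. (g x)\<^sup>2) \<le> 2 * (1 + R\<^sup>2 * h\<^sup>2) * integral {0..h} (\<lambda>x. (f x)\<^sup>2)"
    and "integral {0..h} (\<lambda>x. (f x)\<^sup>2) \<le> 2 * exp (2 * R\<^sup>2 * h\<^sup>2) * integral {0..h} (\<lambda>x. (g x)\<^sup>2)"
proof -
  define Y where "Y x = integral {x..h} (\<lambda>y. (f y)\<^sup>2)" for x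
  define Z where "Z x = integral {x..h} (\<lambda>y. (g y)\<^sup>2)" for x
  define \<kappa> where "\<kappa> = 2 * R\<^sup>2 * h"
  have \<kappa>: "0 \<le> \<kappa>" using h by (simp add: \<kappa>_def)
  have V: "(integral {x..h} (\<lambda>y. k x y * f y))\<^sup>2 \<le> R\<^sup>2 * h * Y x" if "x \<in> {0..h}" for x
    unfolding Y_def by (rule Volterra_square_bound[OF f that]) (use that k R in auto)
  have sq: "(u + v)\<^sup>2 \<le> 2 * u\<^sup>2 + 2 * v\<^sup>2" for u v :: real
    using zero_le_power2[of "u - v"] by (simp add: power2_eq_square algebra_simps)
  have Ymono: "Y x \<le> Y 0" if "x \<in> {0..h}" for x
    unfolding Y_def
    by (rule integral_subset_le)
      (use that in \<open>auto intro!: integrable_continuous_real continuous_intros continuous_on_subset[OF f]\<close>)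
  have "(g x)\<^sup>2 \<le> 2 * (f x)\<^sup>2 + \<kappa> * Y 0" if "x \<in> {0..h}" for x
  proof -
    have "(g x)\<^sup>2 \<le> 2 * (f x)\<^sup>2 + 2 * (integral {x..h} (\<lambda>y. k x y * f y))\<^sup>2"
      using sq[of "f x" "- integral {x..h} (\<lambda>y. k x y * f y)"] eq[OF that] by simp
    also have "\<dots> \<le> 2 * (f x)\<^sup>2 + \<kappa> * Y x"
      using V[OF that] by (simp add: \<kappa>_def)
    also have "\<dots> \<le> 2 * (f x)\<^sup>2 + \<kappa> * Y 0"
      using mult_left_mono[OF Ymono[OF that] \<kappa>] by simp
    finally show ?thesis .
  qed
  then have "integral {0..h} (\<lambda>x. (g x)\<^sup>2) \<le> integral {0..h} (\<lambda>x. 2 * (f x)\<^sup>2 + \<kappa> * Y 0)"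
    by (intro integral_le integrable_continuous_real continuous_intros f g) auto
  also have "\<dots> = 2 * Y 0 + h * (\<kappa> * Y 0)"
    unfolding Y_def using h
    by (subst integral_add) (auto intro!: integrable_continuous_real continuous_intros f)
  also have "\<dots> = 2 * (1 + R\<^sup>2 * h\<^sup>2) * Y 0"
    by (simp add: \<kappa>_def power2_eq_square algebra_simps)
  finally show "integral {0..h} (\<lambda>x. (g x)\<^sup>2) \<le> 2 * (1 + R\<^sup>2 * h\<^sup>2) * integral {0..h} (\<lambda>x. (f x)\<^sup>2)"
    by (simp add: Y_def)
  define W where "W x = exp (\<kappa> * x) * Y x - 2 * exp (\<kappa> * h) * Z x" for x
  have W': "(W has_real_derivative \<kappa> * exp (\<kappa> * x) * Y x - exp (\<kappa> * x) * (f x)\<^sup>2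
        + 2 * exp (\<kappa> * h) * (g x)\<^sup>2) (at x within {0..h})"
    and W'_nonneg: "0 \<le> \<kappa> * exp (\<kappa> * x) * Y x - exp (\<kappa> * x) * (f x)\<^sup>2 + 2 * exp (\<kappa> * h) * (g x)\<^sup>2"
    if x: "x \<in> {0..h}" for x
  proof -
    have "(Y has_real_derivative - (f x)\<^sup>2) (at x within {0..h})"
      "(Z has_real_derivative - (g x)\<^sup>2) (at x within {0..h})"
      unfolding Y_def Z_def
      by (rule integral_has_real_derivative'; use x in \<open>auto intro!: continuous_intros f g\<close>)+
    then show "(W has_real_derivative \<kappa> * exp (\<kappa> * x) * Y x - exp (\<kappa> * x) * (f x)\<^sup>2
        + 2 * exp (\<kappa> * h) * (g x)\<^sup>2) (at x within {0..h})"
      unfolding W_def by (auto intro!: derivative_eq_intros)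
    have "(f x)\<^sup>2 \<le> 2 * (g x)\<^sup>2 + \<kappa> * Y x"
      using sq[of "g x" "integral {x..h} (\<lambda>y. k x y * f y)"] V[OF x] by (simp add: eq[OF x] \<kappa>_def)
    then have "exp (\<kappa> * x) * (f x)\<^sup>2 \<le> exp (\<kappa> * x) * (2 * (g x)\<^sup>2 + \<kappa> * Y x)"
      by (rule mult_left_mono) simp
    moreover have "exp (\<kappa> * x) * (g x)\<^sup>2 \<le> exp (\<kappa> * h) * (g x)\<^sup>2"
      using x \<kappa> by (auto intro!: mult_right_mono mult_left_mono)
    ultimately show "0 \<le> \<kappa> * exp (\<kappa> * x) * Y x - exp (\<kappa> * x) * (f x)\<^sup>2 + 2 * exp (\<kappa> * h) * (g x)\<^sup>2"
      by (simp add: algebra_simps)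
  qed
  have "W 0 \<le> W h"
  proof (rule DERIV_nonneg_imp_increasing_open[OF h])
    show "\<exists>d. (W has_real_derivative d) (at x) \<and> 0 \<le> d" if "0 < x" "x < h" for x
      using W'[of x] W'_nonneg[of x] that at_within_Icc_at[of 0 x h] by auto
    show "continuous_on {0..h} W"
      using W' by (rule DERIV_continuous_on)
  qed
  then show "integral {0..h} (\<lambda>x. (f x)\<^sup>2) \<le> 2 * exp (2 * R\<^sup>2 * h\<^sup>2) * integral {0..h} (\<lambda>x. (g x)\<^sup>2)"
    by (simp add: W_def Y_def Z_def \<kappa>_def power2_eq_square mult.assoc)
qed

section \<open>Splitting the gains with respect to the design parameter\<close>

text \<open>The parts of \<open>p\<^sub>1\<close> and \<open>p\<^sub>4\<close> that do not contain \<open>c\<close>.\<close>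

definition gain_p1_rest :: "real \<Rightarrow> real \<Rightarrow> real \<Rightarrow> real \<Rightarrow> real \<Rightarrow> real \<Rightarrow> real" where
  "gain_p1_rest Di \<beta> lam \<epsilon> h x =
    (\<epsilon> * h / Di - 3 / \<beta>) * lam\<^sup>2 * x * bessel_entire 2 (lam / Di * (h\<^sup>2 - x\<^sup>2))
    + lam ^ 3 / (Di * \<beta>) * x ^ 3 * bessel_entire 3 (lam / Di * (h\<^sup>2 - x\<^sup>2))"

definition gain_p4_rest :: "real \<Rightarrow> real \<Rightarrow> real \<Rightarrow> real \<Rightarrow> real \<Rightarrow> real" where
  "gain_p4_rest Di \<beta> lam \<epsilon> h =
    - (lam / 2 * (1 - lam * h\<^sup>2 / (8 * Di))) + \<beta> * lam / (2 * Di) * \<epsilon> * h"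

text \<open>The coefficient of \<open>E\<close> in the equation for the transformed temperature, at position \<open>x\<close>, thickness \<open>h\<close>
  and speed \<open>v\<close> of the boundary. It does not involve \<open>c\<close>.\<close>

definition source_coeff ::
    "real \<Rightarrow> real \<Rightarrow> real \<Rightarrow> real \<Rightarrow> real \<Rightarrow> real \<Rightarrow> real \<Rightarrow> real" where
  "source_coeff Di \<beta> lam \<epsilon> x h v =
    integral {x..h} (\<lambda>y. obs_kernel (lam / Di) x y * gain_p1_rest Di \<beta> lam \<epsilon> h y)
    - gain_p1_rest Di \<beta> lam \<epsilon> h x
    - v * obs_kernel (lam / Di) x h * (lam / (2 * \<beta>) * h + \<epsilon>)
    - Di / \<beta> * v * obs_kernel_y (lam / Di) x h
    + Di / \<beta> * obs_kernel (lam / Di) x h * gain_p4_rest Di \<beta> lam \<epsilon> h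
    + Di * obs_kernel_y (lam / Di) x h * (lam / (2 * \<beta>) * h + \<epsilon>)
    + Di\<^sup>2 / \<beta> * obs_kernel_yy (lam / Di) x h"

lemma gain_p1_split:
  assumes "Di > 0" "\<beta> > 0" "lam > 0" "0 \<le> x" "x \<le> H t"
  shows "gain_p1 Di \<beta> lam \<epsilon> c H x t =
    c * (Di / \<beta>) * (lam / Di * x * bessel_entire 1 (lam / Di * ((H t)\<^sup>2 - x\<^sup>2)))
      + gain_p1_rest Di \<beta> lam \<epsilon> (H t) x"
proof -
  have "0 \<le> lam / Di * ((H t)\<^sup>2 - x\<^sup>2)"
    using assms by (simp add: power_mono)
  then show ?thesis
    using assms by (simp add: gain_p1_def Let_def bessel_I_quot_eq_entire gain_p1_rest_def del: One_nat_def)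
qed

lemma gain_p4_split: "gain_p4 Di \<beta> lam \<epsilon> c H t = c + gain_p4_rest Di \<beta> lam \<epsilon> (H t)"
  by (simp add: gain_p4_def gain_p4_rest_def)

lemma continuous_on_gain_p1_rest [continuous_intros]:
  "continuous_on A f \<Longrightarrow> continuous_on A g \<Longrightarrow>
    continuous_on A (\<lambda>z. gain_p1_rest Di \<beta> lam \<epsilon> (f z) (g z))"
  unfolding gain_p1_rest_def divide_inverse by (intro continuous_intros)

lemma continuous_on_source_coeff:
  assumes "continuous_on A f" "continuous_on A g" "continuous_on A v" "\<And>z. z \<in> A \<Longrightarrow> f z \<le> g z"
  shows "continuous_on A (\<lambda>z. source_coeff Di \<beta> lam \<epsilon> (f z) (g z) (v z))"
proof -
  have c: "continuous_on {(z, y). z \<in> A \<and> f z \<le> y \<and> y \<le> g z} (\<lambda>z. f (fst z))"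
    "continuous_on {(z, y). z \<in> A \<and> f z \<le> y \<and> y \<le> g z} (\<lambda>z. g (fst z))"
    by (rule continuous_on_compose2[OF assms(1)] continuous_on_compose2[OF assms(2)];
        auto intro!: continuous_intros)+
  have "continuous_on A (\<lambda>z. integral {f z..g z}
      (\<lambda>y. obs_kernel (lam / Di) (f z) y * gain_p1_rest Di \<beta> lam \<epsilon> (g z) y))"
    by (rule continuous_on_integral_moving)
      (auto intro!: continuous_intros c[unfolded case_prod_beta'] assms simp: case_prod_beta')
  then show ?thesis
    unfolding source_coeff_def gain_p4_rest_def divide_inverse
    by (intro continuous_intros assms(1-3))
qed

text \<open>By compactness, with a bound that serves all thickness functions and all \<open>c\<close> at the same time.\<close>

lemma source_coeff_bounded:
  "\<exists>C. \<forall>x h v. 0 \<le> x \<longrightarrow> x \<le> h \<longrightarrow> h \<le> B \<longrightarrow> \<bar>v\<bar> \<le> M \<longrightarrow> \<bar>source_coeff Di \<beta> lam \<epsilon> x h v\<bar> \<le> C"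
proof -
  let ?f = "\<lambda>z. source_coeff Di \<beta> lam \<epsilon> (fst z) (fst (snd z)) (snd (snd z))"
  let ?K = "({0..B} \<times> {0..B} \<times> {-M..M}) \<inter> {z. fst z \<le> fst (snd z)}"
  have "compact ?K"
    by (intro compact_Int_closed compact_Times compact_Icc closed_Collect_le continuous_intros)
  moreover have "continuous_on ?K ?f"
    by (rule continuous_on_source_coeff) (auto intro!: continuous_intros)
  ultimately have "bounded (?f ` ?K)"
    using compact_continuous_image compact_imp_bounded by blast
  then obtain C where "\<forall>w \<in> ?f ` ?K. norm w \<le> C"
    unfolding bounded_iff by blast
  then have C: "\<bar>?f z\<bar> \<le> C" if "z \<in> ?K" for z
    using imageI[OF that, of ?f] unfolding real_norm_def by blast
  show ?thesis
  proof (intro exI allI impI)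
    fix x h v assume "0 \<le> x" "x \<le> h" "h \<le> B" "\<bar>v\<bar> \<le> M"
    then show "\<bar>source_coeff Di \<beta> lam \<epsilon> x h v\<bar> \<le> C"
      using C[of "(x, h, v)"] by (auto simp: abs_le_iff)
  qed
qed

lemma obs_kernel_bounded:
  "\<exists>R. \<forall>x y. 0 \<le> x \<longrightarrow> x \<le> B \<longrightarrow> 0 \<le> y \<longrightarrow> y \<le> B \<longrightarrow> \<bar>obs_kernel a x y\<bar> \<le> R"
proof -
  let ?f = "\<lambda>z. obs_kernel a (fst z) (snd z)"
  have "bounded (?f ` ({0..B} \<times> {0..B}))"
    by (intro compact_imp_bounded compact_continuous_image compact_Times compact_Icc continuous_intros)
  then obtain R where "\<forall>w \<in> ?f ` ({0..B} \<times> {0..B}). norm w \<le> R"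
    unfolding bounded_iff by blast
  then have "\<bar>?f z\<bar> \<le> R" if "z \<in> {0..B} \<times> {0..B}" for z
    using imageI[OF that, of ?f] unfolding real_norm_def by blast
  from this[of "(_, _)"] show ?thesis
    by (intro exI[of _ R]) auto
qed

section \<open>The transformed error system\<close>

text \<open>The comparison of coefficients in the equation for the transformed temperature, with \<open>B = D / \<beta>\<close>. The names
  stand for the values that occur there: \<open>e\<close> is \<open>E\<close>, \<open>p\<close> the temperature error at \<open>x\<close>, \<open>L e\<close> its value
  at the moving boundary, \<open>v\<close> the boundary speed, and \<open>Ik\<close>, \<open>Ixx\<close> are the integrals of \<open>T\<close> against
  the kernel and its second derivative in \<open>x\<close>.\<close>

lemma target_equation_algebra:
  fixes Di \<beta> lam a B L c g4 q r J v x kh ky kxx kyy e p tx txx txh Ik Ixx :: real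
  assumes "\<beta> * B = Di" "Di * a = lam" "Di * kyy = Di * kxx - lam * kh"
  shows "Di * txx - (c * B * q + r) * e -
     (v * (kh * (L * e)) + Di * (kh * txh - ky * (L * e)) -
      Di * (a * x / 2 * tx - - (a\<^sup>2 * x\<^sup>2 / 8) * p) +
      (Di * Ixx - lam * Ik - (c * B * (q - kh) + J) * e)) -
     (B * (ky * v) * e + (- (c + g4) * e - \<beta> * txh) * (B * kh)) =
     Di * (txx + a / 2 * p + a * x / 2 * tx + (a / 2 + a\<^sup>2 * x\<^sup>2 / 8) * p - Ixx - B * kxx * e) -
     lam * (p - Ik - B * kh * e) +
     (J - r - v * kh * L - B * v * ky + B * kh * g4 + Di * ky * L + Di * B * kyy) * e" (is "?l = ?r")
proof -
  have "?l - ?r = txh * kh * (\<beta> * B - Di) - B * e * (Di * kyy - (Di * kxx - lam * kh)) - (Di * a - lam) * p"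
    by (simp add: field_simps power2_eq_square)
  also have "\<dots> = 0" unfolding assms by simp
  finally show ?thesis by simp
qed

text \<open>A classical solution at positive times. The derivatives of \<open>T\<close> and \<open>H\<close> are fixed as functions because the transformed
  state and its derivatives are expressed through them.\<close>

locale classical_error_solution =
  fixes Di \<beta> lam \<epsilon> c :: real and H H' E :: "real \<Rightarrow> real" and T Tt Tx Txx :: "real \<Rightarrow> real \<Rightarrow> real"
  assumes pos: "Di > 0" "\<beta> > 0" "lam > 0" "\<epsilon> > 0"
    and DERIV_H: "\<And>t. 0 < t \<Longrightarrow> (H has_real_derivative H' t) (at t)"
    and cont_H': "continuous_on {0<..} H'"
    and H_pos: "\<And>t. 0 < t \<Longrightarrow> 0 < H t"
    and cont_T: "continuous_on {(x, t). 0 < t \<and> 0 \<le> x \<and> x \<le> H t} (\<lambda>(x, t). T x t)"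
    and cont_Tx: "continuous_on {(x, t). 0 < t \<and> 0 \<le> x \<and> x \<le> H t} (\<lambda>(x, t). Tx x t)"
    and cont_Tt: "continuous_on {(x, t). 0 < t \<and> 0 < x \<and> x < H t} (\<lambda>(x, t). Tt x t)"
    and cont_Txx: "continuous_on {(x, t). 0 < t \<and> 0 < x \<and> x < H t} (\<lambda>(x, t). Txx x t)"
    and DERIV_T_x: "\<And>x t. 0 < t \<Longrightarrow> 0 \<le> x \<Longrightarrow> x \<le> H t \<Longrightarrow>
      ((\<lambda>x. T x t) has_real_derivative Tx x t) (at x within {0..H t})"
    and DERIV_T_t: "\<And>x t. 0 < t \<Longrightarrow> 0 < x \<Longrightarrow> x < H t \<Longrightarrow> (T x has_real_derivative Tt x t) (at t)"
    and DERIV_Tx_x: "\<And>x t. 0 < t \<Longrightarrow> 0 < x \<Longrightarrow> x < H t \<Longrightarrow>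
      ((\<lambda>x. Tx x t) has_real_derivative Txx x t) (at x)"
    and heat: "\<And>x t. 0 < t \<Longrightarrow> 0 < x \<Longrightarrow> x < H t \<Longrightarrow>
      Tt x t = Di * Txx x t - gain_p1 Di \<beta> lam \<epsilon> c H x t * E t"
    and T_left: "\<And>t. 0 < t \<Longrightarrow> T 0 t = 0"
    and T_right: "\<And>t. 0 < t \<Longrightarrow> T (H t) t = (lam / (2 * \<beta>) * H t + \<epsilon>) * E t"
    and DERIV_E: "\<And>t. 0 < t \<Longrightarrow> (E has_real_derivative
      - (c + gain_p4_rest Di \<beta> lam \<epsilon> (H t)) * E t - \<beta> * Tx (H t) t) (at t)"
begin

definition a :: real where "a = lam / Di"

lemma a_pos: "a > 0" and Di_a: "Di * a = lam"
  using pos by (simp_all add: a_def)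

lemma continuous_on_T:
  assumes "continuous_on A f" "continuous_on A g" "\<And>z. z \<in> A \<Longrightarrow> 0 < g z \<and> 0 \<le> f z \<and> f z \<le> H (g z)"
  shows "continuous_on A (\<lambda>z. T (f z) (g z))" "continuous_on A (\<lambda>z. Tx (f z) (g z))"
  using continuous_on_compose2[OF cont_T continuous_on_Pair[OF assms(1,2)]]
    continuous_on_compose2[OF cont_Tx continuous_on_Pair[OF assms(1,2)]] assms(3) by auto

lemma continuous_on_T_interior:
  assumes "continuous_on A f" "continuous_on A g" "\<And>z. z \<in> A \<Longrightarrow> 0 < g z \<and> 0 < f z \<and> f z < H (g z)"
  shows "continuous_on A (\<lambda>z. Tt (f z) (g z))" "continuous_on A (\<lambda>z. Txx (f z) (g z))"
  using continuous_on_compose2[OF cont_Tt continuous_on_Pair[OF assms(1,2)]]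
    continuous_on_compose2[OF cont_Txx continuous_on_Pair[OF assms(1,2)]] assms(3) by auto

lemma continuous_on_time:
  assumes "continuous_on A g" "\<And>z. z \<in> A \<Longrightarrow> 0 < g z"
  shows "continuous_on A (\<lambda>z. H (g z))" "continuous_on A (\<lambda>z. H' (g z))" "continuous_on A (\<lambda>z. E (g z))"
proof -
  have H: "continuous_on {0<..} H"
    by (rule DERIV_continuous_on[OF has_field_derivative_at_within[OF DERIV_H]]) simp
  have E: "continuous_on {0<..} E"
    by (rule DERIV_continuous_on[OF has_field_derivative_at_within[OF DERIV_E]]) simp
  have g: "g ` A \<subseteq> {0<..}"
    using assms(2) by auto
  show "continuous_on A (\<lambda>z. H (g z))" "continuous_on A (\<lambda>z. H' (g z))" "continuous_on A (\<lambda>z. E (g z))"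
    by (rule continuous_on_compose2[OF H assms(1) g] continuous_on_compose2[OF cont_H' assms(1) g]
        continuous_on_compose2[OF E assms(1) g])+
qed

lemma continuous_on_kernel_integral:
  fixes k :: "real \<Rightarrow> real \<Rightarrow> real" and f g :: "'b::topological_space \<Rightarrow> real"
  assumes f: "continuous_on A f" and g: "continuous_on A g"
    and A: "\<And>z. z \<in> A \<Longrightarrow> 0 < g z \<and> 0 \<le> f z \<and> f z \<le> H (g z)"
    and k: "continuous_on UNIV (\<lambda>z. k (fst z) (snd z))"
  shows "continuous_on A (\<lambda>z. integral {f z..H (g z)} (\<lambda>y. k (f z) y * T y (g z)))"
proof (rule continuous_on_integral_moving)
  let ?R = "{z. fst z \<in> A \<and> f (fst z) \<le> snd z \<and> snd z \<le> H (g (fst z))}"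
  have fg: "continuous_on ?R (\<lambda>z. f (fst z))" "continuous_on ?R (\<lambda>z. g (fst z))"
    by (rule continuous_on_compose2[OF f] continuous_on_compose2[OF g]; auto intro!: continuous_intros)+
  have "continuous_on ?R (\<lambda>z. k (f (fst z)) (snd z))"
    using continuous_on_compose2[OF k continuous_on_Pair[OF fg(1) continuous_on_snd[OF continuous_on_id]]]
    by simp
  moreover have "continuous_on ?R (\<lambda>z. T (snd z) (g (fst z)))"
  proof (rule continuous_on_T)
    show "0 < g (fst z) \<and> 0 \<le> snd z \<and> snd z \<le> H (g (fst z))" if "z \<in> ?R" for z
      using A[of "fst z"] that by auto
  qed (auto intro!: continuous_intros fg)
  ultimately have "continuous_on ?R (\<lambda>z. k (f (fst z)) (snd z) * T (snd z) (g (fst z)))"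
    by (rule continuous_on_mult)
  then show "continuous_on {(z, y). z \<in> A \<and> f z \<le> y \<and> y \<le> H (g z)} (\<lambda>(z, y). k (f z) y * T y (g z))"
    by (simp add: case_prod_beta')
qed (use A in \<open>auto intro: f continuous_on_time g\<close>)

text \<open>The transformed temperature and, below, what its derivatives \<open>w\<^sub>x\<close>, \<open>w\<^sub>x\<^sub>x\<close> and \<open>w\<^sub>t\<close> will turn out to be;
  the definition of \<open>wt\<close> is the target equation itself.\<close>

definition w :: "real \<Rightarrow> real \<Rightarrow> real" where
  "w x t = T x t - integral {x..H t} (\<lambda>y. obs_kernel a x y * T y t)
    - Di / \<beta> * obs_kernel a x (H t) * E t"

definition wx :: "real \<Rightarrow> real \<Rightarrow> real" where
  "wx x t = Tx x t + a * x / 2 * T x t - integral {x..H t} (\<lambda>y. obs_kernel_x a x y * T y t)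
    - Di / \<beta> * obs_kernel_x a x (H t) * E t"

definition wxx :: "real \<Rightarrow> real \<Rightarrow> real" where
  "wxx x t = Txx x t + a / 2 * T x t + a * x / 2 * Tx x t + (a / 2 + a\<^sup>2 * x\<^sup>2 / 8) * T x t
    - integral {x..H t} (\<lambda>y. obs_kernel_xx a x y * T y t)
    - Di / \<beta> * obs_kernel_xx a x (H t) * E t"

definition wt :: "real \<Rightarrow> real \<Rightarrow> real" where
  "wt x t = Di * wxx x t - lam * w x t + source_coeff Di \<beta> lam \<epsilon> x (H t) (H' t) * E t"

lemma continuous_on_w:
  assumes "continuous_on A f" "continuous_on A g" "\<And>z. z \<in> A \<Longrightarrow> 0 < g z \<and> 0 \<le> f z \<and> f z \<le> H (g z)"
  shows "continuous_on A (\<lambda>z. w (f z) (g z))" "continuous_on A (\<lambda>z. wx (f z) (g z))"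
    "continuous_on A (\<lambda>z. source_coeff Di \<beta> lam \<epsilon> (f z) (H (g z)) (H' (g z)))"
  unfolding w_def wx_def
  by (intro continuous_intros continuous_on_T continuous_on_kernel_integral continuous_on_time
      continuous_on_source_coeff; use assms in auto)+

lemma continuous_on_w_interior:
  assumes "continuous_on A f" "continuous_on A g" "\<And>z. z \<in> A \<Longrightarrow> 0 < g z \<and> 0 < f z \<and> f z < H (g z)"
  shows "continuous_on A (\<lambda>z. wxx (f z) (g z))" "continuous_on A (\<lambda>z. wt (f z) (g z))"
proof -
  have le: "0 < g z \<and> 0 \<le> f z \<and> f z \<le> H (g z)" if "z \<in> A" for z
    using assms(3)[OF that] by auto
  show *: "continuous_on A (\<lambda>z. wxx (f z) (g z))"
    unfolding wxx_def
    by (intro continuous_intros continuous_on_T continuous_on_T_interior continuous_on_kernel_integral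
        continuous_on_time; use assms le in auto)
  show "continuous_on A (\<lambda>z. wt (f z) (g z))"
    unfolding wt_def
    by (intro continuous_intros * continuous_on_w continuous_on_time; use assms le in auto)
qed

lemma DERIV_w_x:
  assumes t: "0 < t" and x: "0 \<le> x" "x \<le> H t"
  shows "((\<lambda>x. w x t) has_real_derivative wx x t) (at x within {0..H t})"
proof -
  have T: "continuous_on {0..H t} (\<lambda>y. T y t)"
    by (intro continuous_on_T continuous_intros) (use t in auto)
  have "((\<lambda>x. integral {x..H t} (\<lambda>y. obs_kernel a x y * T y t)) has_real_derivative
      integral {x..H t} (\<lambda>y. obs_kernel_x a x y * T y t) - obs_kernel a x x * T x t) (at x within {0..H t})"
    by (rule DERIV_integral_kernel[OF T])
      (use x in \<open>auto intro!: continuous_intros DERIV_obs_kernel simp: case_prod_beta'\<close>)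
  from DERIV_diff[OF DERIV_diff[OF DERIV_T_x[OF t x] this]
      DERIV_cmult_right[OF DERIV_cmult[OF has_field_derivative_at_within[OF DERIV_obs_kernel(1)]]], of "Di / \<beta>" a "H t" "E t"]
  show ?thesis
    unfolding w_def[abs_def] by (rule DERIV_cong) (simp add: wx_def obs_kernel_diagonal)
qed

lemma DERIV_wx_x:
  assumes t: "0 < t" and x: "0 < x" "x < H t"
  shows "((\<lambda>x. wx x t) has_real_derivative wxx x t) (at x)"
proof -
  have T: "continuous_on {0..H t} (\<lambda>y. T y t)"
    by (intro continuous_on_T continuous_intros) (use t in auto)
  have I: "((\<lambda>x. integral {x..H t} (\<lambda>y. obs_kernel_x a x y * T y t)) has_real_derivative
      integral {x..H t} (\<lambda>y. obs_kernel_xx a x y * T y t) - obs_kernel_x a x x * T x t) (at x within {0..H t})"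
    by (rule DERIV_integral_kernel[OF T])
      (use x in \<open>auto intro!: continuous_intros DERIV_obs_kernel simp: case_prod_beta'\<close>)
  note I' = I[unfolded at_within_Icc_at[OF x]]
  note T' = DERIV_T_x[OF t less_imp_le[OF x(1)] less_imp_le[OF x(2)], unfolded at_within_Icc_at[OF x]]
  have lin: "((\<lambda>x. a * x / 2) has_real_derivative a / 2) (at x)"
    by (auto intro!: derivative_eq_intros)
  from DERIV_diff[OF DERIV_diff[OF DERIV_add[OF DERIV_Tx_x[OF t x] DERIV_mult[OF lin T']] I']
      DERIV_cmult_right[OF DERIV_cmult[OF DERIV_obs_kernel(2)]], of "Di / \<beta>" a "H t" "E t"]
  show ?thesis
    unfolding wx_def[abs_def]
    by (rule DERIV_cong) (simp add: wxx_def obs_kernel_diagonal algebra_simps)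
qed

lemma gain_p1_eq:
  assumes "0 \<le> x" "x \<le> H t"
  shows "gain_p1 Di \<beta> lam \<epsilon> c H x t =
    c * (Di / \<beta>) * (a * x * bessel_entire 1 (a * ((H t)\<^sup>2 - x\<^sup>2))) + gain_p1_rest Di \<beta> lam \<epsilon> (H t) x"
  unfolding a_def using pos assms by (intro gain_p1_split)

lemma continuous_on_gain_p1:
  assumes "continuous_on A f" "continuous_on A g" "\<And>z. z \<in> A \<Longrightarrow> 0 < g z \<and> 0 \<le> f z \<and> f z \<le> H (g z)"
  shows "continuous_on A (\<lambda>z. gain_p1 Di \<beta> lam \<epsilon> c H (f z) (g z))"
proof -
  have "continuous_on A (\<lambda>z. c * (Di / \<beta>) * (a * f z * bessel_entire 1 (a * ((H (g z))\<^sup>2 - (f z)\<^sup>2)))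
      + gain_p1_rest Di \<beta> lam \<epsilon> (H (g z)) (f z))"
    by (intro continuous_intros continuous_on_time assms) (use assms(3) in auto)
  then show ?thesis
    by (rule continuous_on_eq) (use assms(3) gain_p1_eq in auto)
qed

text \<open>Here the resolvent identity evaluates the \<open>c\<close>-dependent part of the gain in closed form.\<close>

lemma integral_kernel_gain_p1:
  assumes t: "0 < t" and x: "0 \<le> x" "x \<le> H t"
  shows "integral {x..H t} (\<lambda>y. obs_kernel a x y * gain_p1 Di \<beta> lam \<epsilon> c H y t) =
    c * (Di / \<beta>) * (a * x * bessel_entire 1 (a * ((H t)\<^sup>2 - x\<^sup>2)) - obs_kernel a x (H t))
    + integral {x..H t} (\<lambda>y. obs_kernel a x y * gain_p1_rest Di \<beta> lam \<epsilon> (H t) y)"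
proof (rule integral_unique)
  have "((\<lambda>y. c * (Di / \<beta>) * (obs_kernel a x y * (a * y * bessel_entire 1 (a * ((H t)\<^sup>2 - y\<^sup>2))))
      + obs_kernel a x y * gain_p1_rest Di \<beta> lam \<epsilon> (H t) y) has_integral
    c * (Di / \<beta>) * (a * x * bessel_entire 1 (a * ((H t)\<^sup>2 - x\<^sup>2)) - obs_kernel a x (H t))
    + integral {x..H t} (\<lambda>y. obs_kernel a x y * gain_p1_rest Di \<beta> lam \<epsilon> (H t) y)) {x..H t}"
    by (intro has_integral_add has_integral_mult_right obs_kernel_resolvent a_pos x
        integrable_integral integrable_continuous_real continuous_intros)
  then show "((\<lambda>y. obs_kernel a x y * gain_p1 Di \<beta> lam \<epsilon> c H y t) has_integral
    c * (Di / \<beta>) * (a * x * bessel_entire 1 (a * ((H t)\<^sup>2 - x\<^sup>2)) - obs_kernel a x (H t))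
    + integral {x..H t} (\<lambda>y. obs_kernel a x y * gain_p1_rest Di \<beta> lam \<epsilon> (H t) y)) {x..H t}"
    by (rule has_integral_eq[rotated]) (use x in \<open>simp add: gain_p1_eq distrib_left mult_ac\<close>)
qed

text \<open>By the heat equation and Green's second identity in differential form,
  \<open>k T\<^sub>t = (D (k T\<^sub>y - k\<^sub>y T))\<^sub>y + (D k\<^sub>y\<^sub>y T - k p\<^sub>1 E)\<close>: a conservation law whose flux and source are continuous
  up to the boundary although \<open>T\<^sub>t\<close> need not be.\<close>

lemma DERIV_kernel_integral_t:
  assumes t: "0 < t" and x: "0 < x" "x < H t"
  shows "((\<lambda>t. integral {x..H t} (\<lambda>y. obs_kernel a x y * T y t)) has_real_derivative
    H' t * (obs_kernel a x (H t) * T (H t) t)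
    + Di * (obs_kernel a x (H t) * Tx (H t) t - obs_kernel_y a x (H t) * T (H t) t)
    - Di * (obs_kernel a x x * Tx x t - obs_kernel_y a x x * T x t)
    + integral {x..H t} (\<lambda>y. Di * obs_kernel_yy a x y * T y t
        - obs_kernel a x y * gain_p1 Di \<beta> lam \<epsilon> c H y t * E t)) (at t)"
proof (rule DERIV_integral_conservation_law[where J = "{s. 0 < s \<and> x < H s}"
      and ut = "\<lambda>y t. obs_kernel a x y * Tt y t"
      and P = "\<lambda>y t. Di * (obs_kernel a x y * Tx y t - obs_kernel_y a x y * T y t)"
      and S = "\<lambda>y t. Di * obs_kernel_yy a x y * T y t - obs_kernel a x y * gain_p1 Di \<beta> lam \<epsilon> c H y t * E t"])
  let ?J = "{s. 0 < s \<and> x < H s}"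
  have "?J = {0<..} \<inter> H -` {x<..}" by auto
  moreover have "open ({0<..} \<inter> H -` {x<..})"
    by (intro continuous_open_preimage continuous_on_time continuous_intros) auto
  ultimately show "open ?J" by simp
  show "t \<in> ?J" using t x by simp
  show "continuous_on ?J H'" by (intro continuous_on_time continuous_intros) auto
  let ?R = "{(y, s). s \<in> ?J \<and> x \<le> y \<and> y \<le> H s}"
  show "continuous_on ?R (\<lambda>(y, t). obs_kernel a x y * T y t)"
    "continuous_on ?R (\<lambda>(y, t). Di * (obs_kernel a x y * Tx y t - obs_kernel_y a x y * T y t))"
    "continuous_on ?R (\<lambda>(y, t). Di * obs_kernel_yy a x y * T y t
        - obs_kernel a x y * gain_p1 Di \<beta> lam \<epsilon> c H y t * E t)"
    unfolding case_prod_beta'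
    by (intro continuous_intros continuous_on_T continuous_on_gain_p1 continuous_on_time; use x in auto)+
  show "continuous_on {(y, s). s \<in> ?J \<and> x < y \<and> y < H s} (\<lambda>(y, t). obs_kernel a x y * Tt y t)"
    unfolding case_prod_beta'
    by (intro continuous_intros continuous_on_T_interior; use x in auto)
  fix y s assume s: "s \<in> ?J" and y: "x < y" "y < H s"
  have sy: "0 < s" "0 < y" using s x y by auto
  show "((\<lambda>s. obs_kernel a x y * T y s) has_real_derivative obs_kernel a x y * Tt y s) (at s)"
    by (intro DERIV_cmult DERIV_T_t sy y)
  have T': "((\<lambda>y. T y s) has_real_derivative Tx y s) (at y)"
    using DERIV_T_x[of s y] at_within_Icc_at[of 0 y "H s"] sy y by auto
  from DERIV_cmult[OF DERIV_diff[OF DERIV_mult[OF DERIV_obs_kernel(3) DERIV_Tx_x[OF sy y(2)]]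
        DERIV_mult[OF DERIV_obs_kernel(4) T']], of Di a x a x]
  show "((\<lambda>y. Di * (obs_kernel a x y * Tx y s - obs_kernel_y a x y * T y s)) has_real_derivative
      obs_kernel a x y * Tt y s - (Di * obs_kernel_yy a x y * T y s
        - obs_kernel a x y * gain_p1 Di \<beta> lam \<epsilon> c H y s * E s)) (at y)"
    by (rule DERIV_cong) (simp add: heat[OF sy y(2)] algebra_simps)
qed (use DERIV_H in auto)

text \<open>The wave equation of the kernel turns \<open>D k\<^sub>y\<^sub>y\<close> into \<open>D k\<^sub>x\<^sub>x - \<lambda> k\<close>, both under the integral and at the
  boundary; its diagonal values leave the damping \<open>- \<lambda> T\<close> at \<open>x\<close>; the flux at the boundary
  cancels against the one in \<open>E'\<close>; and the terms proportional to \<open>c\<close> cancel by the resolvent identity.\<close>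

lemma DERIV_w_t:
  assumes t: "0 < t" and x: "0 < x" "x < H t"
  shows "(w x has_real_derivative wt x t) (at t)"
proof -
  define h where "h = H t"
  define I where "I k = integral {x..h} (\<lambda>y. k x y * T y t)" for k :: "real \<Rightarrow> real \<Rightarrow> real"
  define q where "q = a * x * bessel_entire 1 (a * (h\<^sup>2 - x\<^sup>2))"
  define J where "J = integral {x..h} (\<lambda>y. obs_kernel a x y * gain_p1_rest Di \<beta> lam \<epsilon> h y)"
  have cT: "continuous_on {x..h} (\<lambda>y. T y t)"
    by (intro continuous_on_T continuous_intros) (use t x in \<open>auto simp: h_def\<close>)
  have cp: "continuous_on {x..h} (\<lambda>y. gain_p1 Di \<beta> lam \<epsilon> c H y t)"
    by (intro continuous_on_gain_p1 continuous_intros) (use t x in \<open>auto simp: h_def\<close>)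
  have wave: "Di * obs_kernel_yy a x y = Di * obs_kernel_xx a x y - lam * obs_kernel a x y" for y
  proof -
    have "Di * (obs_kernel_xx a x y - obs_kernel_yy a x y) = Di * a * obs_kernel a x y"
      by (simp add: obs_kernel_wave_equation)
    then show ?thesis
      unfolding Di_a by (simp add: right_diff_distrib)
  qed
  have "integral {x..h} (\<lambda>y. Di * obs_kernel_yy a x y * T y t - obs_kernel a x y * gain_p1 Di \<beta> lam \<epsilon> c H y t * E t)
      = Di * I (obs_kernel_xx a) - lam * I (obs_kernel a) - (c * (Di / \<beta>) * (q - obs_kernel a x h) + J) * E t"
  proof (rule integral_unique)
    have "((\<lambda>y. Di * (obs_kernel_xx a x y * T y t) - lam * (obs_kernel a x y * T y t)
          - obs_kernel a x y * gain_p1 Di \<beta> lam \<epsilon> c H y t * E t) has_integral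
        Di * I (obs_kernel_xx a) - lam * I (obs_kernel a) - (c * (Di / \<beta>) * (q - obs_kernel a x h) + J) * E t) {x..h}"
      unfolding I_def q_def J_def
      unfolding h_def
      unfolding integral_kernel_gain_p1[OF t less_imp_le[OF x(1)] less_imp_le[OF x(2)], symmetric]
      unfolding h_def[symmetric]
      by (intro has_integral_diff has_integral_mult_right has_integral_mult_left integrable_integral
          integrable_continuous_real continuous_intros cT cp)
    moreover have "Di * (obs_kernel_xx a x y * T y t) - lam * (obs_kernel a x y * T y t)
        = Di * obs_kernel_yy a x y * T y t" for y
      unfolding wave by (simp add: left_diff_distrib)
    ultimately show "((\<lambda>y. Di * obs_kernel_yy a x y * T y t
          - obs_kernel a x y * gain_p1 Di \<beta> lam \<epsilon> c H y t * E t) has_integral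
        Di * I (obs_kernel_xx a) - lam * I (obs_kernel a) - (c * (Di / \<beta>) * (q - obs_kernel a x h) + J) * E t) {x..h}"
      by simp
  qed
  note I' = DERIV_kernel_integral_t[OF t x, folded h_def, unfolded this]
  have kE: "((\<lambda>s. Di / \<beta> * obs_kernel a x (H s) * E s) has_real_derivative
      Di / \<beta> * (obs_kernel_y a x h * H' t) * E t + (- (c + gain_p4_rest Di \<beta> lam \<epsilon> h) * E t - \<beta> * Tx h t)
        * (Di / \<beta> * obs_kernel a x h)) (at t)"
    unfolding h_def
    by (intro DERIV_mult DERIV_cmult DERIV_E t DERIV_chain2[OF DERIV_obs_kernel(3) DERIV_H])
  have b: "\<beta> * (Di / \<beta>) = Di" "Di\<^sup>2 / \<beta> = Di * (Di / \<beta>)"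
    using pos by (simp_all add: power2_eq_square)
  note heat' = heat[OF t x, unfolded gain_p1_eq[OF less_imp_le[OF x(1)] less_imp_le[OF x(2)]],
      folded h_def, folded q_def]
  have Tr: "T h t = (lam / (2 * \<beta>) * h + \<epsilon>) * E t"
    using T_right[OF t] by (simp add: h_def)
  from DERIV_diff[OF DERIV_diff[OF DERIV_T_t[OF t x] I'] kE]
  show ?thesis
    unfolding w_def[abs_def]
  proof (rule DERIV_cong)
    define L where "L = lam / (2 * \<beta>) * h + \<epsilon>"
    define B where "B = Di / \<beta>"
    show "Tt x t - (H' t * (obs_kernel a x h * T h t)
        + Di * (obs_kernel a x h * Tx h t - obs_kernel_y a x h * T h t)
        - Di * (obs_kernel a x x * Tx x t - obs_kernel_y a x x * T x t)
        + (Di * I (obs_kernel_xx a) - lam * I (obs_kernel a) - (c * (Di / \<beta>) * (q - obs_kernel a x h) + J) * E t))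
      - (Di / \<beta> * (obs_kernel_y a x h * H' t) * E t + (- (c + gain_p4_rest Di \<beta> lam \<epsilon> h) * E t - \<beta> * Tx h t)
        * (Di / \<beta> * obs_kernel a x h)) = wt x t"
      unfolding wt_def wxx_def w_def source_coeff_def h_def[symmetric] a_def[symmetric]
        J_def[symmetric] I_def[symmetric] b(2) obs_kernel_diagonal heat' Tr L_def[symmetric] B_def[symmetric]
      by (rule target_equation_algebra) (use b(1)[folded B_def] Di_a wave[of h] in auto)
  qed
qed

lemma w_left: "0 < t \<Longrightarrow> w 0 t = 0"
  by (simp add: w_def T_left)

lemma w_right:
  assumes "0 < t"
  shows "w (H t) t = \<epsilon> * E t"
proof -
  have "Di / \<beta> * (a * H t / 2) = Di * a / (2 * \<beta>) * H t"
    by simp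
  then have "Di / \<beta> * (a * H t / 2) = lam / (2 * \<beta>) * H t"
    unfolding Di_a .
  moreover have "w (H t) t = (lam / (2 * \<beta>) * H t + \<epsilon>) * E t - Di / \<beta> * (a * H t / 2) * E t"
    unfolding w_def T_right[OF assms] obs_kernel_diagonal by simp
  ultimately show ?thesis
    by (simp only: distrib_right add_diff_cancel_left')
qed

text \<open>Rewriting the flux in terms of \<open>w\<close> consumes \<open>p\<^sub>4\<close> up to the residue \<open>\<lambda>\<^sup>2 H\<^sup>2 / (16 D)\<close>.\<close>

lemma DERIV_E_target:
  assumes t: "0 < t"
  shows "(E has_real_derivative - (c - lam\<^sup>2 * (H t)\<^sup>2 / (16 * Di)) * E t - \<beta> * wx (H t) t) (at t)"
proof (rule DERIV_cong[OF DERIV_E[OF t]])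
  have wx: "wx (H t) t = Tx (H t) t + a * H t / 2 * ((lam / (2 * \<beta>) * H t + \<epsilon>) * E t)
      - Di / \<beta> * (a / 2 + a\<^sup>2 * (H t)\<^sup>2 / 8) * E t"
    using t by (simp add: wx_def T_right obs_kernel_diagonal)
  show "- (c + gain_p4_rest Di \<beta> lam \<epsilon> (H t)) * E t - \<beta> * Tx (H t) t =
      - (c - lam\<^sup>2 * (H t)\<^sup>2 / (16 * Di)) * E t - \<beta> * wx (H t) t"
    unfolding wx using pos by (simp add: gain_p4_rest_def a_def field_simps power2_eq_square)
qed

lemma continuous_on_profiles:
  assumes t: "0 < t"
  shows "continuous_on {0..H t} (\<lambda>x. w x t)" "continuous_on {0..H t} (\<lambda>x. wx x t)"
    "continuous_on {0..H t} (\<lambda>x. source_coeff Di \<beta> lam \<epsilon> x (H t) (H' t))"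
    "continuous_on {0..H t} (\<lambda>x. T x t)"
  by (intro continuous_on_w continuous_on_T continuous_intros; use t in auto)+

section \<open>Decay of the energy\<close>

text \<open>The energy density obeys the conservation law
  \<open>(w\<^sup>2 / 2)\<^sub>t = (D w w\<^sub>x)\<^sub>x + (g E w - D w\<^sub>x\<^sup>2 - \<lambda> w\<^sup>2)\<close>.\<close>

lemma DERIV_energy_w:
  assumes t: "0 < t"
  shows "((\<lambda>t. integral {0..H t} (\<lambda>x. (w x t)\<^sup>2 / 2)) has_real_derivative
    H' t * (\<epsilon> * E t)\<^sup>2 / 2 + Di * (\<epsilon> * E t * wx (H t) t)
    + integral {0..H t} (\<lambda>x. source_coeff Di \<beta> lam \<epsilon> x (H t) (H' t) * E t * w x t
        - Di * (wx x t)\<^sup>2 - lam * (w x t)\<^sup>2)) (at t)"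
proof -
  let ?S = "\<lambda>x t. source_coeff Di \<beta> lam \<epsilon> x (H t) (H' t) * E t * w x t
        - Di * (wx x t)\<^sup>2 - lam * (w x t)\<^sup>2"
  have "((\<lambda>t. integral {0..H t} (\<lambda>x. (w x t)\<^sup>2 / 2)) has_real_derivative
    H' t * ((w (H t) t)\<^sup>2 / 2) + Di * (w (H t) t * wx (H t) t) - Di * (w 0 t * wx 0 t)
      + integral {0..H t} (\<lambda>x. ?S x t)) (at t)"
  proof (rule DERIV_integral_conservation_law[where J = "{0<..}"
        and ut = "\<lambda>x t. w x t * wt x t" and P = "\<lambda>x t. Di * (w x t * wx x t)" and S = ?S])
    let ?R = "{(x, t). t \<in> {0<..} \<and> 0 \<le> x \<and> x \<le> H t}"
    show "continuous_on ?R (\<lambda>(x, t). (w x t)\<^sup>2 / 2)" "continuous_on ?R (\<lambda>(x, t). Di * (w x t * wx x t))"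
      "continuous_on ?R (\<lambda>(x, t). ?S x t)"
      unfolding case_prod_beta'
      by (intro continuous_intros continuous_on_w continuous_on_time; auto)+
    show "continuous_on {(x, t). t \<in> {0<..} \<and> 0 < x \<and> x < H t} (\<lambda>(x, t). w x t * wt x t)"
      unfolding case_prod_beta'
      by (intro continuous_intros continuous_on_w continuous_on_w_interior; auto)
    fix x s assume s: "s \<in> {0<..}" and x: "0 < x" "x < H s"
    have s': "0 < s" using s by simp
    show "((\<lambda>t. (w x t)\<^sup>2 / 2) has_real_derivative w x s * wt x s) (at s)"
      using DERIV_w_t[OF s' x] by (auto intro!: derivative_eq_intros)
    have "((\<lambda>x. w x s) has_real_derivative wx x s) (at x)"
      using DERIV_w_x[OF s' less_imp_le[OF x(1)] less_imp_le[OF x(2)]] at_within_Icc_at[OF x] by simp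
    from DERIV_cmult[OF DERIV_mult[OF this DERIV_wx_x[OF s' x]], of Di]
    show "((\<lambda>x. Di * (w x s * wx x s)) has_real_derivative w x s * wt x s - ?S x s) (at x)"
      by (rule DERIV_cong) (simp add: wt_def power2_eq_square algebra_simps)
  qed (use t DERIV_H H_pos cont_H' in auto)
  then show ?thesis
    by (rule DERIV_cong) (use t in \<open>simp add: w_left w_right power2_eq_square\<close>)
qed

text \<open>The weight of \<open>E\<^sup>2\<close> is the one for which the boundary flux \<open>w\<^sub>x(H)\<close> drops out of the derivative.\<close>

definition V :: "real \<Rightarrow> real" where
  "V t = integral {0..H t} (\<lambda>x. (w x t)\<^sup>2 / 2) + \<epsilon> * Di / (2 * \<beta>) * (E t)\<^sup>2"

definition V' :: "real \<Rightarrow> real" where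
  "V' t = H' t * (\<epsilon> * E t)\<^sup>2 / 2
    + integral {0..H t} (\<lambda>x. source_coeff Di \<beta> lam \<epsilon> x (H t) (H' t) * E t * w x t
        - Di * (wx x t)\<^sup>2 - lam * (w x t)\<^sup>2)
    - \<epsilon> * Di / \<beta> * (c - lam\<^sup>2 * (H t)\<^sup>2 / (16 * Di)) * (E t)\<^sup>2"

lemma DERIV_V:
  assumes t: "0 < t"
  shows "(V has_real_derivative V' t) (at t)"
proof -
  have "((\<lambda>t. (E t)\<^sup>2) has_real_derivative
      2 * E t * (- (c - lam\<^sup>2 * (H t)\<^sup>2 / (16 * Di)) * E t - \<beta> * wx (H t) t)) (at t)"
    using DERIV_E_target[OF t] by (auto intro!: derivative_eq_intros)
  from DERIV_add[OF DERIV_energy_w[OF t] DERIV_cmult[OF this, of "\<epsilon> * Di / (2 * \<beta>)"]]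
  show ?thesis
    unfolding V_def[abs_def]
  proof (rule DERIV_cong)
    define D where "D = c - lam\<^sup>2 * (H t)\<^sup>2 / (16 * Di)"
    have "\<epsilon> * Di / (2 * \<beta>) * (2 * E t * (- D * E t - \<beta> * wx (H t) t))
        = - (\<epsilon> * Di / \<beta> * D * (E t)\<^sup>2) - Di * (\<epsilon> * E t * wx (H t) t)"
      using pos by (simp add: field_simps power2_eq_square)
    then show "H' t * (\<epsilon> * E t)\<^sup>2 / 2 + Di * (\<epsilon> * E t * wx (H t) t)
        + integral {0..H t} (\<lambda>x. source_coeff Di \<beta> lam \<epsilon> x (H t) (H' t) * E t * w x t
          - Di * (wx x t)\<^sup>2 - lam * (w x t)\<^sup>2)
        + \<epsilon> * Di / (2 * \<beta>) * (2 * E t * (- (c - lam\<^sup>2 * (H t)\<^sup>2 / (16 * Di)) * E t - \<beta> * wx (H t) t)) = V' t"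
      by (simp add: V'_def D_def)
  qed
qed

text \<open>The threshold for \<open>c\<close> is twice the sum of three losses, measured against the weight \<open>\<epsilon> D / \<beta>\<close> of \<open>E\<^sup>2\<close>:
  the residue in the thickness equation, the motion of the boundary, and the share of the source left over by Young's inequality.\<close>

lemma V'_le:
  assumes t: "0 < t" and H: "H t \<le> Hbar" and H'M: "\<bar>H' t\<bar> \<le> M"
    and K: "\<And>x. 0 \<le> x \<Longrightarrow> x \<le> H t \<Longrightarrow> \<bar>source_coeff Di \<beta> lam \<epsilon> x (H t) (H' t)\<bar> \<le> K"
    and c: "0 \<le> c" "lam\<^sup>2 * Hbar\<^sup>2 / (8 * Di) + \<beta> / (\<epsilon> * Di) * (\<epsilon>\<^sup>2 * M + K\<^sup>2 * Hbar / lam) \<le> c"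
  shows "V' t \<le> - min lam c * V t"
proof -
  define N where "N = integral {0..H t} (\<lambda>x. (w x t)\<^sup>2)"
  note cw = continuous_on_profiles[OF t]
  have N: "0 \<le> N" unfolding N_def by (intro integral_nonneg integrable_continuous_real continuous_intros cw) auto
  have V: "V t = N / 2 + \<epsilon> * Di / (2 * \<beta>) * (E t)\<^sup>2"
    by (simp add: V_def N_def)
  let ?g = "\<lambda>x. source_coeff Di \<beta> lam \<epsilon> x (H t) (H' t)"
  have young: "?g x * E t * w x t - Di * (wx x t)\<^sup>2 - lam * (w x t)\<^sup>2
      \<le> K\<^sup>2 * (E t)\<^sup>2 / (2 * lam) - lam / 2 * (w x t)\<^sup>2" if "x \<in> {0..H t}" for x
  proof -
    have "(?g x)\<^sup>2 \<le> K\<^sup>2"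
      using power_mono[OF K[of x] abs_ge_zero, of 2] that by simp
    then have "(?g x)\<^sup>2 * (E t)\<^sup>2 / (2 * lam) \<le> K\<^sup>2 * (E t)\<^sup>2 / (2 * lam)"
      using pos by (intro divide_right_mono mult_right_mono) auto
    moreover have "?g x * E t * w x t \<le> (?g x)\<^sup>2 * (E t)\<^sup>2 / (2 * lam) + lam / 2 * (w x t)\<^sup>2"
    proof -
      have "0 \<le> (?g x * E t - lam * w x t)\<^sup>2 / (2 * lam)"
        using pos by simp
      also have "\<dots> = (?g x)\<^sup>2 * (E t)\<^sup>2 / (2 * lam) + lam / 2 * (w x t)\<^sup>2 - ?g x * E t * w x t"
        using pos by (simp add: field_simps power2_eq_square)
      finally show ?thesis by simp
    qed
    moreover have "0 \<le> Di * (wx x t)\<^sup>2" using pos by simp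
    moreover have "lam * (w x t)\<^sup>2 = lam / 2 * (w x t)\<^sup>2 + lam / 2 * (w x t)\<^sup>2" by simp
    ultimately show ?thesis by linarith
  qed
  have "integral {0..H t} (\<lambda>x. ?g x * E t * w x t - Di * (wx x t)\<^sup>2 - lam * (w x t)\<^sup>2)
      \<le> integral {0..H t} (\<lambda>x. K\<^sup>2 * (E t)\<^sup>2 / (2 * lam) - lam / 2 * (w x t)\<^sup>2)"
    by (intro integral_le integrable_continuous_real continuous_intros cw young) auto
  also have "\<dots> = H t * (K\<^sup>2 * (E t)\<^sup>2 / (2 * lam)) - lam / 2 * N"
    unfolding N_def using H_pos[OF t]
    by (subst integral_diff) (auto intro!: integrable_continuous_real continuous_intros cw)
  also have "\<dots> \<le> Hbar * (K\<^sup>2 * (E t)\<^sup>2 / (2 * lam)) - lam / 2 * N"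
    using H pos by (simp add: mult_right_mono divide_right_mono)
  finally have 1: "integral {0..H t} (\<lambda>x. ?g x * E t * w x t - Di * (wx x t)\<^sup>2 - lam * (w x t)\<^sup>2)
      \<le> Hbar * (K\<^sup>2 * (E t)\<^sup>2 / (2 * lam)) - lam / 2 * N" .
  have 2: "H' t * (\<epsilon> * E t)\<^sup>2 / 2 \<le> M * (\<epsilon> * E t)\<^sup>2 / 2"
    using H'M by (intro divide_right_mono mult_right_mono) auto
  define \<kappa> where "\<kappa> = \<epsilon> * Di / \<beta>"
  have \<kappa>: "\<kappa> > 0" using pos by (simp add: \<kappa>_def)
  have "(H t)\<^sup>2 \<le> Hbar\<^sup>2"
    using H H_pos[OF t] by (intro power_mono) auto
  then have "lam\<^sup>2 * (H t)\<^sup>2 / (16 * Di) \<le> lam\<^sup>2 * Hbar\<^sup>2 / (16 * Di)"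
    using pos by (intro divide_right_mono mult_left_mono) auto
  then have 3: "\<kappa> * (lam\<^sup>2 * (H t)\<^sup>2 / (16 * Di)) * (E t)\<^sup>2 \<le> \<kappa> * (lam\<^sup>2 * Hbar\<^sup>2 / (16 * Di)) * (E t)\<^sup>2"
    using \<kappa> by (intro mult_right_mono mult_left_mono) auto
  have \<kappa>_cancel: "\<kappa> * (\<beta> / (\<epsilon> * Di) * y) = y" for y
    using pos by (simp add: \<kappa>_def)
  have "\<kappa> * (lam\<^sup>2 * Hbar\<^sup>2 / (8 * Di)) + (\<epsilon>\<^sup>2 * M + K\<^sup>2 * Hbar / lam)
      = \<kappa> * (lam\<^sup>2 * Hbar\<^sup>2 / (8 * Di) + \<beta> / (\<epsilon> * Di) * (\<epsilon>\<^sup>2 * M + K\<^sup>2 * Hbar / lam))"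
    by (simp only: distrib_left[of \<kappa> "lam\<^sup>2 * Hbar\<^sup>2 / (8 * Di)"] \<kappa>_cancel)
  also have "\<dots> \<le> \<kappa> * c"
    using c(2) \<kappa> by (intro mult_left_mono) auto
  finally have "\<kappa> * (lam\<^sup>2 * Hbar\<^sup>2 / (8 * Di)) + (\<epsilon>\<^sup>2 * M + K\<^sup>2 * Hbar / lam) \<le> \<kappa> * c" .
  then have "(\<kappa> * (lam\<^sup>2 * Hbar\<^sup>2 / (8 * Di)) + (\<epsilon>\<^sup>2 * M + K\<^sup>2 * Hbar / lam)) / 2 * (E t)\<^sup>2 \<le> \<kappa> * c / 2 * (E t)\<^sup>2"
    by (intro mult_right_mono divide_right_mono) auto
  moreover have "(\<kappa> * (lam\<^sup>2 * Hbar\<^sup>2 / (8 * Di)) + (\<epsilon>\<^sup>2 * M + K\<^sup>2 * Hbar / lam)) / 2 * (E t)\<^sup>2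
    = \<kappa> * (lam\<^sup>2 * Hbar\<^sup>2 / (16 * Di)) * (E t)\<^sup>2 + M * (\<epsilon> * E t)\<^sup>2 / 2 + Hbar * (K\<^sup>2 * (E t)\<^sup>2 / (2 * lam))"
    using pos by (simp add: field_simps power2_eq_square)
  moreover have "V' t = H' t * (\<epsilon> * E t)\<^sup>2 / 2
    + integral {0..H t} (\<lambda>x. ?g x * E t * w x t - Di * (wx x t)\<^sup>2 - lam * (w x t)\<^sup>2)
    - \<kappa> * c * (E t)\<^sup>2 + \<kappa> * (lam\<^sup>2 * (H t)\<^sup>2 / (16 * Di)) * (E t)\<^sup>2"
    by (simp add: V'_def \<kappa>_def algebra_simps)
  moreover have "\<kappa> * c * (E t)\<^sup>2 = \<kappa> * c / 2 * (E t)\<^sup>2 + \<kappa> * c / 2 * (E t)\<^sup>2"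
    by simp
  ultimately have "V' t \<le> - (lam / 2 * N) - \<kappa> * c / 2 * (E t)\<^sup>2"
    using 1 2 3 by linarith
  also have "\<dots> \<le> - (min lam c / 2 * N) - min lam c * \<kappa> / 2 * (E t)\<^sup>2"
  proof -
    have "min lam c / 2 * N \<le> lam / 2 * N" using N by (intro mult_right_mono) auto
    moreover have "min lam c * \<kappa> / 2 * (E t)\<^sup>2 \<le> c * \<kappa> / 2 * (E t)\<^sup>2"
      using \<kappa> by (intro mult_right_mono divide_right_mono) auto
    ultimately show ?thesis by (simp add: mult.commute)
  qed
  also have "\<dots> = - min lam c * V t"
    unfolding V \<kappa>_def by (simp add: algebra_simps)
  finally show ?thesis .
qed

lemma V_decay:
  assumes V': "\<And>t. 0 < t \<Longrightarrow> V' t \<le> - \<mu> * V t" and s: "0 < s" "s \<le> t"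
  shows "V t \<le> V s * exp (- \<mu> * (t - s))"
proof -
  have "V t * exp (\<mu> * t) \<le> V s * exp (\<mu> * s)"
  proof (rule DERIV_nonpos_imp_nonincreasing[OF s(2)])
    fix r assume "s \<le> r" "r \<le> t"
    then have r: "0 < r" using s by simp
    have "((\<lambda>t. V t * exp (\<mu> * t)) has_real_derivative (V' r + \<mu> * V r) * exp (\<mu> * r)) (at r)"
      using DERIV_V[OF r] by (auto intro!: derivative_eq_intros simp: algebra_simps)
    moreover have "(V' r + \<mu> * V r) * exp (\<mu> * r) \<le> 0"
      using V'[OF r] by (intro mult_nonpos_nonneg) auto
    ultimately show "\<exists>y. ((\<lambda>t. V t * exp (\<mu> * t)) has_real_derivative y) (at r) \<and> y \<le> 0"
      by blast
  qed
  then have "V t * exp (\<mu> * t) * exp (- \<mu> * t) \<le> V s * exp (\<mu> * s) * exp (- \<mu> * t)"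
    by (rule mult_right_mono) simp
  then show ?thesis
    by (simp add: mult.assoc right_diff_distrib flip: exp_add)
qed

section \<open>Equivalence of the norms\<close>

text \<open>The Volterra bounds apply to \<open>T\<close> and \<open>g = w + (D / \<beta>) k x H E\<close>; the passage between \<open>g\<close> and \<open>w\<close> costs a
  multiple of \<open>E\<^sup>2\<close>. The constant is a common upper bound for all factors that occur, and it does not involve \<open>c\<close>.\<close>

lemma w_T_norm_equivalence:
  assumes t: "0 < t" and H: "H t \<le> Hbar"
    and R: "\<And>x y. 0 \<le> x \<Longrightarrow> x \<le> Hbar \<Longrightarrow> 0 \<le> y \<Longrightarrow> y \<le> Hbar \<Longrightarrow> \<bar>obs_kernel a x y\<bar> \<le> R"
    and C: "C = 4 * exp (2 * R\<^sup>2 * Hbar\<^sup>2) * (1 + R\<^sup>2 * Hbar\<^sup>2) * (1 + (Di / \<beta> * R)\<^sup>2 * Hbar)"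
  shows "integral {0..H t} (\<lambda>x. (w x t)\<^sup>2) \<le> C * error_norm H T E t"
    and "integral {0..H t} (\<lambda>x. (T x t)\<^sup>2) \<le> C * (integral {0..H t} (\<lambda>x. (w x t)\<^sup>2) + (E t)\<^sup>2)"
proof -
  note cw = continuous_on_profiles[OF t]
  define h where "h = H t"
  have h: "0 < h" "h \<le> Hbar" using H_pos[OF t] H by (simp_all add: h_def)
  define F where "F = (Di / \<beta> * R)\<^sup>2 * Hbar"
  define \<phi> where "\<phi> x = Di / \<beta> * obs_kernel a x h * E t" for x
  define g where "g x = w x t + \<phi> x" for x
  define NT where "NT = integral {0..h} (\<lambda>x. (T x t)\<^sup>2)"
  define Nw where "Nw = integral {0..h} (\<lambda>x. (w x t)\<^sup>2)"
  define Ng where "Ng = integral {0..h} (\<lambda>x. (g x)\<^sup>2)"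
  have c: "continuous_on {0..h} (\<lambda>x. w x t)" "continuous_on {0..h} (\<lambda>x. T x t)"
    using cw by (simp_all add: h_def)
  have c\<phi>: "continuous_on {0..h} \<phi>"
    unfolding \<phi>_def by (intro continuous_intros)
  have cg: "continuous_on {0..h} g"
    unfolding g_def by (intro continuous_intros c c\<phi>)
  have nonneg: "0 \<le> NT" "0 \<le> Nw"
    unfolding NT_def Nw_def
    by (intro integral_nonneg integrable_continuous_real continuous_intros c; simp)+
  have Hb: "0 \<le> Hbar" using h by simp
  have "(\<phi> x)\<^sup>2 \<le> (Di / \<beta> * R)\<^sup>2 * (E t)\<^sup>2" if "x \<in> {0..h}" for x
  proof -
    have "\<bar>Di / \<beta> * obs_kernel a x h\<bar> \<le> Di / \<beta> * R"
      unfolding abs_mult using R[of x h] that h pos by (intro mult_mono) auto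
    then have "(Di / \<beta> * obs_kernel a x h)\<^sup>2 \<le> (Di / \<beta> * R)\<^sup>2"
      by (rule order_trans[OF eq_refl[OF power2_abs[symmetric]] power_mono[OF _ abs_ge_zero]])
    then show ?thesis
      unfolding \<phi>_def power_mult_distrib[of _ "E t"] by (rule mult_right_mono) simp
  qed
  then have "integral {0..h} (\<lambda>x. (\<phi> x)\<^sup>2) \<le> integral {0..h} (\<lambda>x. (Di / \<beta> * R)\<^sup>2 * (E t)\<^sup>2)"
    by (intro integral_le integrable_continuous_real continuous_intros c\<phi>)
  also have "\<dots> = h * ((Di / \<beta> * R)\<^sup>2 * (E t)\<^sup>2)"
    using h by simp
  also have "\<dots> \<le> Hbar * ((Di / \<beta> * R)\<^sup>2 * (E t)\<^sup>2)"
    using h by (intro mult_right_mono) auto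
  finally have \<phi>_bound: "integral {0..h} (\<lambda>x. (\<phi> x)\<^sup>2) \<le> F * (E t)\<^sup>2"
    by (simp add: F_def mult_ac)
  have sum_bound: "integral {0..h} (\<lambda>x. (u x)\<^sup>2) \<le> 2 * integral {0..h} (\<lambda>x. (v x)\<^sup>2) + 2 * (F * (E t)\<^sup>2)"
    if "continuous_on {0..h} u" "continuous_on {0..h} v" "\<And>x. u x = v x + \<phi> x \<or> v x = u x + \<phi> x" for u v
  proof -
    have sq: "(u x)\<^sup>2 \<le> 2 * (v x)\<^sup>2 + 2 * (\<phi> x)\<^sup>2" for x
      using that(3)[of x] zero_le_power2[of "v x - \<phi> x"] zero_le_power2[of "v x + \<phi> x"]
        zero_le_power2[of "u x + 2 * \<phi> x"]
      by (auto simp: power2_eq_square algebra_simps)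
    have "integral {0..h} (\<lambda>x. (u x)\<^sup>2) \<le> integral {0..h} (\<lambda>x. 2 * (v x)\<^sup>2 + 2 * (\<phi> x)\<^sup>2)"
      by (intro integral_le integrable_continuous_real continuous_intros that(1,2) c\<phi> sq)
    also have "\<dots> = 2 * integral {0..h} (\<lambda>x. (v x)\<^sup>2) + 2 * integral {0..h} (\<lambda>x. (\<phi> x)\<^sup>2)"
      by (subst integral_add) (auto intro!: integrable_continuous_real continuous_intros that(1,2) c\<phi>)
    finally show ?thesis using \<phi>_bound by simp
  qed
  have geq: "g x = T x t - integral {x..h} (\<lambda>y. obs_kernel a x y * T y t)" for x
    by (simp add: g_def \<phi>_def w_def h_def)
  have Rh: "R\<^sup>2 * h\<^sup>2 \<le> R\<^sup>2 * Hbar\<^sup>2"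
    using h by (intro mult_left_mono power_mono) auto
  have kc: "continuous_on {x..h} (\<lambda>y. obs_kernel a x y)" for x
    by (intro continuous_intros)
  have kR: "\<bar>obs_kernel a x y\<bar> \<le> R" if "0 \<le> x" "x \<le> y" "y \<le> h" for x y
    using R[of x y] that h by linarith
  note volt = Volterra_transform_L2_bounds[OF less_imp_le[OF h(1)] c(2) cg kc kR geq,
      folded Ng_def NT_def]
  define X where "X = exp (2 * R\<^sup>2 * Hbar\<^sup>2)"
  define Y where "Y = 1 + R\<^sup>2 * Hbar\<^sup>2"
  define Z where "Z = 1 + F"
  have F: "0 \<le> F" using Hb by (simp add: F_def)
  have XYZ: "1 \<le> X" "1 \<le> Y" "1 \<le> Z"
    using F by (simp_all add: X_def Y_def Z_def)
  have C': "C = 4 * (X * Y * Z)"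
    by (simp add: C X_def Y_def Z_def F_def)
  have FZ: "F \<le> Z"
    by (simp add: Z_def)
  have "1 * 1 \<le> X * Y" "X * 1 \<le> X * Y" "1 * Y \<le> X * Y"
    using XYZ by (intro mult_mono; simp)+
  then have XY: "1 \<le> X * Y" "X \<le> X * Y" "Y \<le> X * Y"
    by simp_all
  have "X * 1 \<le> X * Y * Z" "Y * 1 \<le> X * Y * Z" "X * F \<le> X * Y * Z" "1 * F \<le> X * Y * Z"
    by (rule mult_mono; use XY XYZ F FZ in linarith)+
  then have le: "X \<le> X * Y * Z" "Y \<le> X * Y * Z" "X * F \<le> X * Y * Z" "F \<le> X * Y * Z"
    by simp_all
  have "Nw \<le> 2 * Ng + 2 * (F * (E t)\<^sup>2)"
    unfolding Nw_def Ng_def by (rule sum_bound) (auto simp: g_def intro: c cg[unfolded g_def])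
  also have "\<dots> \<le> 4 * (Y * NT) + 4 * (F * (E t)\<^sup>2)"
  proof -
    have "(1 + R\<^sup>2 * h\<^sup>2) * NT \<le> Y * NT"
      using Rh nonneg by (intro mult_right_mono) (auto simp: Y_def)
    moreover have "0 \<le> F * (E t)\<^sup>2" using F by simp
    ultimately show ?thesis using volt(1) by linarith
  qed
  also have "\<dots> \<le> 4 * (X * Y * Z * NT) + 4 * (X * Y * Z * (E t)\<^sup>2)"
    using le nonneg by (intro add_mono mult_left_mono mult_right_mono) auto
  finally show "integral {0..H t} (\<lambda>x. (w x t)\<^sup>2) \<le> C * error_norm H T E t"
    by (simp add: C' error_norm_def Nw_def NT_def h_def algebra_simps)
  have "NT \<le> 2 * exp (2 * R\<^sup>2 * h\<^sup>2) * Ng" by (rule volt)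
  also have "\<dots> \<le> 2 * X * (2 * Nw + 2 * (F * (E t)\<^sup>2))"
  proof (intro mult_mono)
    show "exp (2 * R\<^sup>2 * h\<^sup>2) \<le> X"
      using Rh by (simp add: X_def)
    show "Ng \<le> 2 * Nw + 2 * (F * (E t)\<^sup>2)"
      unfolding Nw_def Ng_def by (rule sum_bound) (auto simp: g_def intro: c cg[unfolded g_def])
    show "0 \<le> Ng"
      unfolding Ng_def by (intro integral_nonneg integrable_continuous_real continuous_intros cg) simp
  qed (use XYZ in auto)
  also have "\<dots> = 4 * (X * Nw) + 4 * (X * F * (E t)\<^sup>2)"
    by (simp add: algebra_simps)
  also have "\<dots> \<le> 4 * (X * Y * Z * Nw) + 4 * (X * Y * Z * (E t)\<^sup>2)"
    using le nonneg by (intro add_mono mult_left_mono mult_right_mono) auto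
  finally show "integral {0..H t} (\<lambda>x. (T x t)\<^sup>2) \<le> C * (integral {0..H t} (\<lambda>x. (w x t)\<^sup>2) + (E t)\<^sup>2)"
    by (simp add: C' Nw_def NT_def h_def algebra_simps)
qed

end

section \<open>Exponential stability\<close>

lemma classical_error_solution_of_error_system:
  assumes "Di > 0" "\<beta> > 0" "lam > 0" "\<epsilon> > 0"
    and adm: "admissible_thickness Hbar M H" and sol: "error_system_solution Di \<beta> lam \<epsilon> c H T E"
  obtains H' Tt Tx Txx where "classical_error_solution Di \<beta> lam \<epsilon> c H H' E T Tt Tx Txx"
    "\<And>t. 0 < t \<Longrightarrow> \<bar>H' t\<bar> < M" "\<And>t. 0 < t \<Longrightarrow> H t < Hbar"
proof -
  obtain H' where H': "\<And>t. 0 \<le> t \<Longrightarrow> (H has_real_derivative H' t) (at t within {0..})"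
    "continuous_on {0..} H'" "\<And>t. 0 < t \<Longrightarrow> \<bar>H' t\<bar> < M"
    and H: "\<And>t. 0 < t \<Longrightarrow> 0 < H t" "\<And>t. 0 < t \<Longrightarrow> H t < Hbar"
    using adm unfolding admissible_thickness_def by auto
  have H'_at: "(H has_real_derivative H' t) (at t)" if "0 < t" for t
    using H'(1)[of t] that at_within_open_subset[of t "{0<..}" "{0..}"] by (auto simp: subset_iff)
  obtain Tt Tx Txx where S:
      "continuous_on {(x, t). 0 < t \<and> 0 \<le> x \<and> x \<le> H t} (\<lambda>(x, t). T x t)"
      "continuous_on {(x, t). 0 < t \<and> 0 \<le> x \<and> x \<le> H t} (\<lambda>(x, t). Tx x t)"
      "continuous_on {(x, t). 0 < t \<and> 0 < x \<and> x < H t} (\<lambda>(x, t). Tt x t)"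
      "continuous_on {(x, t). 0 < t \<and> 0 < x \<and> x < H t} (\<lambda>(x, t). Txx x t)"
      "\<forall>t>0. \<forall>x\<in>{0..H t}. ((\<lambda>\<xi>. T \<xi> t) has_real_derivative Tx x t) (at x within {0..H t})"
      "\<forall>t>0. \<forall>x\<in>{0<..<H t}.
        ((\<lambda>\<tau>. T x \<tau>) has_real_derivative Tt x t) (at t) \<and>
        ((\<lambda>\<xi>. Tx \<xi> t) has_real_derivative Txx x t) (at x) \<and>
        Tt x t = Di * Txx x t - gain_p1 Di \<beta> lam \<epsilon> c H x t * E t"
      "\<forall>t>0. T 0 t = - gain_p2 t * E t"
      "\<forall>t>0. T (H t) t = - gain_p3 \<beta> lam \<epsilon> H t * E t"
      "\<forall>t>0. (E has_real_derivative
        (- gain_p4 Di \<beta> lam \<epsilon> c H t * E t - \<beta> * Tx (H t) t)) (at t)"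
    using sol unfolding error_system_solution_def by blast
  have "classical_error_solution Di \<beta> lam \<epsilon> c H H' E T Tt Tx Txx"
  proof
    show "continuous_on {0<..} H'"
      by (rule continuous_on_subset[OF H'(2)]) auto
    show "(T x has_real_derivative Tt x t) (at t)" if "0 < t" "0 < x" "x < H t" for x t
      using S(6)[rule_format, unfolded greaterThanLessThan_iff, OF that(1) conjI[OF that(2,3)]] by blast
    show "T 0 t = 0" if "0 < t" for t
      using S(7) that by (simp add: gain_p2_def)
    show "T (H t) t = (lam / (2 * \<beta>) * H t + \<epsilon>) * E t" if "0 < t" for t
      using S(8) that by (simp add: gain_p3_def)
    show "(E has_real_derivative - (c + gain_p4_rest Di \<beta> lam \<epsilon> (H t)) * E t - \<beta> * Tx (H t) t) (at t)"
      if "0 < t" for t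
      using S(9) that by (simp add: gain_p4_split)
  qed (use assms(1-4) H'_at H(1) S(1-6) in auto)
  then show thesis using that H'(3) H(2) by blast
qed

lemma (in classical_error_solution) V_equivalent:
  assumes \<kappa>: "\<kappa> = \<epsilon> * Di / \<beta>" and t: "0 < t"
  shows "V t \<le> max 1 \<kappa> / 2 * (integral {0..H t} (\<lambda>x. (w x t)\<^sup>2) + (E t)\<^sup>2)"
    and "min 1 \<kappa> / 2 * (integral {0..H t} (\<lambda>x. (w x t)\<^sup>2) + (E t)\<^sup>2) \<le> V t"
proof -
  define N where "N = integral {0..H t} (\<lambda>x. (w x t)\<^sup>2)"
  have N: "0 \<le> N"
    unfolding N_def by (intro integral_nonneg integrable_continuous_real continuous_intros continuous_on_profiles t) simp
  have V: "V t = 1 / 2 * N + \<kappa> / 2 * (E t)\<^sup>2"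
    by (simp add: V_def N_def \<kappa>)
  have "1 / 2 * N \<le> max 1 \<kappa> / 2 * N" "\<kappa> / 2 * (E t)\<^sup>2 \<le> max 1 \<kappa> / 2 * (E t)\<^sup>2"
    "min 1 \<kappa> / 2 * N \<le> 1 / 2 * N" "min 1 \<kappa> / 2 * (E t)\<^sup>2 \<le> \<kappa> / 2 * (E t)\<^sup>2"
    by (rule mult_right_mono; simp add: N)+
  then show "V t \<le> max 1 \<kappa> / 2 * (integral {0..H t} (\<lambda>x. (w x t)\<^sup>2) + (E t)\<^sup>2)"
    "min 1 \<kappa> / 2 * (integral {0..H t} (\<lambda>x. (w x t)\<^sup>2) + (E t)\<^sup>2) \<le> V t"
    unfolding V N_def[symmetric] distrib_left by linarith+
qed

theorem theorem1:
  fixes Di \<beta> lam \<epsilon> Hbar M :: real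
  assumes "Di > 0" and "\<beta> > 0" and "lam > 0" and "\<epsilon> > 0" and "Hbar > 0" and "M > 0"
  shows "\<exists>cstar>0. \<exists>Mtilde>0. \<forall>H c T E.
    admissible_thickness Hbar M H \<longrightarrow> c > cstar \<longrightarrow>
    error_system_solution Di \<beta> lam \<epsilon> c H T E \<longrightarrow>
    (\<forall>t\<ge>0. error_norm H T E t \<le> Mtilde * error_norm H T E 0 * exp (- min lam c * t))"
proof -
  obtain K where K: "\<And>x h v. 0 \<le> x \<Longrightarrow> x \<le> h \<Longrightarrow> h \<le> Hbar \<Longrightarrow> \<bar>v\<bar> \<le> M \<Longrightarrow>
      \<bar>source_coeff Di \<beta> lam \<epsilon> x h v\<bar> \<le> K"
    using source_coeff_bounded[of Hbar M Di \<beta> lam \<epsilon>] by blast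
  obtain R where R: "\<And>x y. 0 \<le> x \<Longrightarrow> x \<le> Hbar \<Longrightarrow> 0 \<le> y \<Longrightarrow> y \<le> Hbar \<Longrightarrow>
      \<bar>obs_kernel (lam / Di) x y\<bar> \<le> R"
    using obs_kernel_bounded[of Hbar "lam / Di"] by blast
  define cstar where "cstar = max 1 (lam\<^sup>2 * Hbar\<^sup>2 / (8 * Di)
      + \<beta> / (\<epsilon> * Di) * (\<epsilon>\<^sup>2 * M + K\<^sup>2 * Hbar / lam))"
  define C where "C = 4 * exp (2 * R\<^sup>2 * Hbar\<^sup>2) * (1 + R\<^sup>2 * Hbar\<^sup>2) * (1 + (Di / \<beta> * R)\<^sup>2 * Hbar)"
  define \<kappa> where "\<kappa> = \<epsilon> * Di / \<beta>"
  have \<kappa>: "\<kappa> > 0" using assms by (simp add: \<kappa>_def)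
  have C: "C \<ge> 0" unfolding C_def using assms by simp
  define Mtilde where "Mtilde = max 1 ((C + 1) / (min 1 \<kappa> / 2) * (max 1 \<kappa> / 2 * (C + 1)))"
  show ?thesis
  proof (intro exI conjI allI impI)
    show "cstar > 0" by (simp add: cstar_def)
    show "Mtilde > 0" by (simp add: Mtilde_def)
    fix H c T E t
    assume adm: "admissible_thickness Hbar M H" and c: "c > cstar"
      and sol: "error_system_solution Di \<beta> lam \<epsilon> c H T E" and t: "(0::real) \<le> t"
    obtain H' Tt Tx Txx where "classical_error_solution Di \<beta> lam \<epsilon> c H H' E T Tt Tx Txx"
      and H'M: "\<And>t. 0 < t \<Longrightarrow> \<bar>H' t\<bar> < M" and HH: "\<And>t. 0 < t \<Longrightarrow> H t < Hbar"
      using classical_error_solution_of_error_system[OF assms(1-4) adm sol] by blast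
    then interpret classical_error_solution Di \<beta> lam \<epsilon> c H H' E T Tt Tx Txx by simp
    let ?\<Phi> = "error_norm H T E"
    define \<mu> where "\<mu> = min lam c"
    have V': "V' s \<le> - \<mu> * V s" if "0 < s" for s
      unfolding \<mu>_def
    proof (rule V'_le[OF that])
      show "0 \<le> c" "lam\<^sup>2 * Hbar\<^sup>2 / (8 * Di) + \<beta> / (\<epsilon> * Di) * (\<epsilon>\<^sup>2 * M + K\<^sup>2 * Hbar / lam) \<le> c"
        using c by (auto simp: cstar_def)
    qed (use HH[OF that] H'M[OF that] K in auto)
    define N where "N s = integral {0..H s} (\<lambda>x. (w x s)\<^sup>2) + (E s)\<^sup>2" for s
    have \<Phi>_nonneg: "0 \<le> ?\<Phi> s" for s
    proof (cases "(\<lambda>x. (T x s)\<^sup>2) integrable_on {0..H s}")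
      case True
      then show ?thesis
        by (simp add: error_norm_def integral_nonneg)
    next
      case False
      then show ?thesis
        by (simp add: error_norm_def not_integrable_integral)
    qed
    have \<Phi>_N: "N s \<le> (C + 1) * ?\<Phi> s" "?\<Phi> s \<le> (C + 1) * N s" if s: "0 < s" for s
    proof -
      note eqv = w_T_norm_equivalence[OF s less_imp_le[OF HH[OF s]] R[folded a_def] C_def]
      have nonneg: "0 \<le> integral {0..H s} (\<lambda>x. (w x s)\<^sup>2)" "0 \<le> integral {0..H s} (\<lambda>x. (T x s)\<^sup>2)"
        by (intro integral_nonneg integrable_continuous_real continuous_intros continuous_on_profiles s; simp)+
      show "N s \<le> (C + 1) * ?\<Phi> s"
        using eqv(1) nonneg(2) by (simp add: N_def distrib_right) (simp add: error_norm_def)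
      show "?\<Phi> s \<le> (C + 1) * N s"
        using eqv(2) nonneg(1) by (simp add: N_def distrib_right error_norm_def)
    qed
    have decay: "?\<Phi> t \<le> Mtilde * ?\<Phi> s * exp (- \<mu> * (t - s))" if s: "0 < s" "s \<le> t" for s
    proof -
      have t: "0 < t" using s by simp
      have "?\<Phi> t \<le> (C + 1) * N t" by (rule \<Phi>_N[OF t])
      also have "\<dots> \<le> (C + 1) / (min 1 \<kappa> / 2) * V t"
      proof -
        have "(C + 1) * N t = (C + 1) / (min 1 \<kappa> / 2) * (min 1 \<kappa> / 2 * N t)"
          using \<kappa> by (simp add: min_def)
        also have "\<dots> \<le> (C + 1) / (min 1 \<kappa> / 2) * V t"
          unfolding N_def using \<kappa> C by (intro mult_left_mono V_equivalent(2)[OF \<kappa>_def t]) auto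
        finally show ?thesis .
      qed
      also have "\<dots> \<le> (C + 1) / (min 1 \<kappa> / 2) * (V s * exp (- \<mu> * (t - s)))"
        using V_decay[OF V' s] \<kappa> C by (intro mult_left_mono) auto
      also have "\<dots> \<le> (C + 1) / (min 1 \<kappa> / 2) * ((max 1 \<kappa> / 2 * ((C + 1) * ?\<Phi> s)) * exp (- \<mu> * (t - s)))"
      proof (intro mult_left_mono mult_right_mono)
        have "V s \<le> max 1 \<kappa> / 2 * N s"
          unfolding N_def by (rule V_equivalent(1)[OF \<kappa>_def s(1)])
        also have "\<dots> \<le> max 1 \<kappa> / 2 * ((C + 1) * ?\<Phi> s)"
          using \<Phi>_N(1)[OF s(1)] by (intro mult_left_mono) auto
        finally show "V s \<le> max 1 \<kappa> / 2 * ((C + 1) * ?\<Phi> s)" .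
      qed (use \<kappa> C in auto)
      also have "\<dots> = ((C + 1) / (min 1 \<kappa> / 2) * (max 1 \<kappa> / 2 * (C + 1))) * (?\<Phi> s * exp (- \<mu> * (t - s)))"
        by (simp only: mult_ac)
      also have "\<dots> \<le> Mtilde * (?\<Phi> s * exp (- \<mu> * (t - s)))"
        using \<Phi>_nonneg[of s] by (intro mult_right_mono) (auto simp: Mtilde_def)
      finally show ?thesis by (simp only: mult.assoc)
    qed
    show "?\<Phi> t \<le> Mtilde * ?\<Phi> 0 * exp (- min lam c * t)"
    \<comment> \<open>The case \<open>t = 0\<close> is the reason for the lower bound \<open>1\<close> in \<open>Mtilde\<close>.\<close>
    proof (cases "t = 0")
      case True
      have "1 * ?\<Phi> 0 \<le> Mtilde * ?\<Phi> 0"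
        using \<Phi>_nonneg[of 0] by (intro mult_right_mono) (auto simp: Mtilde_def)
      then show ?thesis using True by simp
    next
      case False
      then have t: "0 < t" using t by simp
      have "continuous (at 0 within {0..}) ?\<Phi>"
        using sol by (simp add: error_system_solution_def)
      then have "(?\<Phi> \<longlongrightarrow> ?\<Phi> 0) (at_right 0)"
        unfolding continuous_within by (rule tendsto_within_subset) auto
      then have "((\<lambda>s. Mtilde * ?\<Phi> s * exp (- \<mu> * (t - s))) \<longlongrightarrow> Mtilde * ?\<Phi> 0 * exp (- \<mu> * (t - 0))) (at_right 0)"
        by (intro tendsto_intros)
      moreover have "\<forall>\<^sub>F s in at_right 0. ?\<Phi> t \<le> Mtilde * ?\<Phi> s * exp (- \<mu> * (t - s))"
        using eventually_at_right_less[of 0] eventually_at_right_real[OF t]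
        by eventually_elim (use decay in auto)
      ultimately have "?\<Phi> t \<le> Mtilde * ?\<Phi> 0 * exp (- \<mu> * (t - 0))"
        by (rule tendsto_lowerbound) simp
      then show ?thesis by (simp add: \<mu>_def)
    qed
  qed
qed

end
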